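(* Let $I$ be a non-empty set, let $(\mathbb{C}_i)_{i\in I}$ be a family of non-empty categories, and for each $i\in I$ let $(\mathcal{T}_i,\mathcal{F}_i)$ be a pair of subcategories of $\mathbb{C}_i$. Then the pair $$\left(\prod_{i\in I}\mathcal{T}_i,\ \prod_{i\in I}\mathcal{F}_i\right)$$ is a pretorsion theory in the product category $\prod_{i\in I}\mathbb{C}_i$ if and only if, for each $i\in I$, $(\mathcal{T}_i,\mathcal{F}_i)$ is a pretorsion theory in $\mathbb{C}_i$. Moreover, when these are pretorsion theories, $(\mathcal{T}_i,\mathcal{F}_i)$ is thin for every $i\in I$ if and only if $\left(\prod_{i\in I}\mathcal{T}_i,\prod_{i\in I}\mathcal{F}_i\right)$ is thin.
   Context: Let $\mathcal{C}$ be a category and $\mathcal{T},\mathcal{F}$ subcategories of $\mathcal{C}$; put $\mathcal{Z}=\mathcal{T}\cap\mathcal{F}$. A morphism of $\mathcal{C}$ is called null if it factors through an object of $\mathcal{Z}$; let $\mathcal{N}$ be the ideal of null morphisms. A morphism $k\colon K\to A$ is a kernel of $f\colon A\to B$ (relative to $\mathcal{N}$) if $fk$ is null and for every $u\colon U\to A$ with $fu$ null there is a unique $u'\colon U\to K$ with $u=ku'$. Dually, $c\colon B\to Q$ is a cokernel of $f\colon A\to B$ if $cf$ is null and for every $v\colon B\to V$ with $vf$ null there is a unique $v'\colon Q\to V$ with $v=v'c$. A short exact sequence is a sequence $A\xrightarrow{m}B\xrightarrow{e}C$ such that $m$ is a kernel of $e$ and $e$ is a cokernel of $m$. A pretorsion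 theory in $\mathcal{C}$ is a pair $(\mathcal{T},\mathcal{F})$ of full replete (i.e. closed under isomorphism) subcategories of $\mathcal{C}$ such that: (T1) every morphism from an object of $\mathcal{T}$ to an object of $\mathcal{F}$ is null; (T2) for every object $C$ of $\mathcal{C}$ there is a short exact sequence $T\to C\to F$ with $T\in\mathcal{T}$ and $F\in\mathcal{F}$. Given a pretorsion theory $(\mathcal{T},\mathcal{F})$ in $\mathcal{C}$, choose for each object $X$ a short exact sequence $t(X)\xrightarrow{m_X}X\xrightarrow{e_X}f(X)$ as in (T2) (it is unique up to canonical isomorphism); $t(X)$ and $f(X)$ are the torsion and torsion-free parts of $X$. For $g\colon X\to Y$, $t(g)$ is the unique morphism with $m_Y\,t(g)=g\,m_X$ and $f(g)$ is the unique morphism with $f(g)\,e_X=e_Y\,g$; this defines functors $t\colon\mathcal{C}\to\mathcal{T}$ and $f\colon\mathcal{C}\to\mathcal{F}$. The pretorsion theory is called thin if the functor $\mathcal{C}\to\mathcal{T}\times\mathcal{F}$, $X\mapsto(t(X),f(X))$, is an equivalence of categories. *)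

theory Defs
  imports "HOL-Library.FuncSet"
begin

section \<open>Categories and subcategories\<close>

text \<open>Categories live on carrier sets inside arbitrary types; the operations are unconstrained
  outside the carriers. \<open>Comp C g f\<close> is the composite of \<open>g\<close> after \<open>f\<close>.\<close>

record ('o, 'm) cat =
  Obj :: "'o set"
  Mor :: "'m set"
  Dom :: "'m \<Rightarrow> 'o"
  Cod :: "'m \<Rightarrow> 'o"
  Ident :: "'o \<Rightarrow> 'm"
  Comp :: "'m \<Rightarrow> 'm \<Rightarrow> 'm"

definition Hom :: "('o, 'm) cat \<Rightarrow> 'o \<Rightarrow> 'o \<Rightarrow> 'm set" where
  "Hom C A B = {f \<in> Mor C. Dom C f = A \<and> Cod C f = B}"

locale category =
  fixes C :: "('o, 'm) cat"
  assumes Dom_in: "f \<in> Mor C \<Longrightarrow> Dom C f \<in> Obj C"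
    and Cod_in: "f \<in> Mor C \<Longrightarrow> Cod C f \<in> Obj C"
    and Ident_in: "A \<in> Obj C \<Longrightarrow> Ident C A \<in> Hom C A A"
    and Comp_in: "\<lbrakk>f \<in> Mor C; g \<in> Mor C; Dom C g = Cod C f\<rbrakk>
      \<Longrightarrow> Comp C g f \<in> Hom C (Dom C f) (Cod C g)"
    and Comp_Ident_left: "f \<in> Mor C \<Longrightarrow> Comp C (Ident C (Cod C f)) f = f"
    and Comp_Ident_right: "f \<in> Mor C \<Longrightarrow> Comp C f (Ident C (Dom C f)) = f"
    and Comp_assoc: "\<lbrakk>f \<in> Mor C; g \<in> Mor C; h \<in> Mor C; Dom C g = Cod C f; Dom C h = Cod C g\<rbrakk>
      \<Longrightarrow> Comp C h (Comp C g f) = Comp C (Comp C h g) f"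

text \<open>A subcategory is again a \<open>cat\<close> record, so that the product of subcategories is literally a
  product of categories. It has to agree with the ambient category on its own carriers only.\<close>

locale subcategory = S: category S + C: category C for S C :: "('o, 'm) cat" +
  assumes Obj_sub: "Obj S \<subseteq> Obj C"
    and Mor_sub: "Mor S \<subseteq> Mor C"
    and Dom_sub: "f \<in> Mor S \<Longrightarrow> Dom S f = Dom C f"
    and Cod_sub: "f \<in> Mor S \<Longrightarrow> Cod S f = Cod C f"
    and Ident_sub: "A \<in> Obj S \<Longrightarrow> Ident S A = Ident C A"
    and Comp_sub: "\<lbrakk>f \<in> Mor S; g \<in> Mor S; Dom S g = Cod S f\<rbrakk> \<Longrightarrow> Comp S g f = Comp C g f"

definition is_iso :: "('o, 'm) cat \<Rightarrow> 'm \<Rightarrow> bool" where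
  "is_iso C f \<longleftrightarrow> f \<in> Mor C \<and>
    (\<exists>g \<in> Hom C (Cod C f) (Dom C f).
      Comp C g f = Ident C (Dom C f) \<and> Comp C f g = Ident C (Cod C f))"

definition full_subcategory :: "('o, 'm) cat \<Rightarrow> ('o, 'm) cat \<Rightarrow> bool" where
  "full_subcategory S C \<longleftrightarrow> subcategory S C \<and>
    (\<forall>A \<in> Obj S. \<forall>B \<in> Obj S. Hom C A B \<subseteq> Mor S)"

definition replete :: "('o, 'm) cat \<Rightarrow> ('o, 'm) cat \<Rightarrow> bool" where
  "replete S C \<longleftrightarrow> (\<forall>f. is_iso C f \<and> Dom C f \<in> Obj S \<longrightarrow> Cod C f \<in> Obj S)"

section \<open>Products of categories\<close>

text \<open>Families are extensional functions on the index set, so that equality of objects and of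
  morphisms of the product is equality of all components.\<close>

definition prod_cat :: "'i set \<Rightarrow> ('i \<Rightarrow> ('o, 'm) cat) \<Rightarrow> ('i \<Rightarrow> 'o, 'i \<Rightarrow> 'm) cat" where
  "prod_cat I C =
    \<lparr>Obj = (\<Pi>\<^sub>E i\<in>I. Obj (C i)),
     Mor = (\<Pi>\<^sub>E i\<in>I. Mor (C i)),
     Dom = (\<lambda>f. \<lambda>i\<in>I. Dom (C i) (f i)),
     Cod = (\<lambda>f. \<lambda>i\<in>I. Cod (C i) (f i)),
     Ident = (\<lambda>A. \<lambda>i\<in>I. Ident (C i) (A i)),
     Comp = (\<lambda>g f. \<lambda>i\<in>I. Comp (C i) (g i) (f i))\<rparr>"

definition binprod_cat ::
  "('o1, 'm1) cat \<Rightarrow> ('o2, 'm2) cat \<Rightarrow> ('o1 \<times> 'o2, 'm1 \<times> 'm2) cat" where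
  "binprod_cat C D =
    \<lparr>Obj = Obj C \<times> Obj D,
     Mor = Mor C \<times> Mor D,
     Dom = map_prod (Dom C) (Dom D),
     Cod = map_prod (Cod C) (Cod D),
     Ident = map_prod (Ident C) (Ident D),
     Comp = (\<lambda>g f. (Comp C (fst g) (fst f), Comp D (snd g) (snd f)))\<rparr>"

section \<open>Functors and equivalences\<close>

record ('o1, 'm1, 'o2, 'm2) fctr =
  OMap :: "'o1 \<Rightarrow> 'o2"
  MMap :: "'m1 \<Rightarrow> 'm2"

definition is_functor ::
  "('o1, 'm1) cat \<Rightarrow> ('o2, 'm2) cat \<Rightarrow> ('o1, 'm1, 'o2, 'm2) fctr \<Rightarrow> bool" where
  "is_functor C D G \<longleftrightarrow>
    (\<forall>A \<in> Obj C. OMap G A \<in> Obj D) \<and>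
    (\<forall>f \<in> Mor C. MMap G f \<in> Hom D (OMap G (Dom C f)) (OMap G (Cod C f))) \<and>
    (\<forall>A \<in> Obj C. MMap G (Ident C A) = Ident D (OMap G A)) \<and>
    (\<forall>f \<in> Mor C. \<forall>g \<in> Mor C. Dom C g = Cod C f \<longrightarrow>
      MMap G (Comp C g f) = Comp D (MMap G g) (MMap G f))"

definition id_functor :: "('o, 'm, 'o, 'm) fctr" where
  "id_functor = \<lparr>OMap = (\<lambda>A. A), MMap = (\<lambda>f. f)\<rparr>"

definition comp_functor ::
  "('o2, 'm2, 'o3, 'm3) fctr \<Rightarrow> ('o1, 'm1, 'o2, 'm2) fctr \<Rightarrow> ('o1, 'm1, 'o3, 'm3) fctr" where
  "comp_functor H G = \<lparr>OMap = OMap H \<circ> OMap G, MMap = MMap H \<circ> MMap G\<rparr>"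

definition naturally_isomorphic ::
  "('o1, 'm1) cat \<Rightarrow> ('o2, 'm2) cat \<Rightarrow> ('o1, 'm1, 'o2, 'm2) fctr \<Rightarrow>
    ('o1, 'm1, 'o2, 'm2) fctr \<Rightarrow> bool" where
  "naturally_isomorphic C D G H \<longleftrightarrow>
    (\<exists>\<eta>. (\<forall>A \<in> Obj C. \<eta> A \<in> Hom D (OMap G A) (OMap H A) \<and> is_iso D (\<eta> A)) \<and>
         (\<forall>f \<in> Mor C. Comp D (\<eta> (Cod C f)) (MMap G f) = Comp D (MMap H f) (\<eta> (Dom C f))))"

definition is_equivalence ::
  "('o1, 'm1) cat \<Rightarrow> ('o2, 'm2) cat \<Rightarrow> ('o1, 'm1, 'o2, 'm2) fctr \<Rightarrow> bool" where
  "is_equivalence C D G \<longleftrightarrow> is_functor C D G \<and>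
    (\<exists>H. is_functor D C H \<and>
      naturally_isomorphic C C (comp_functor H G) id_functor \<and>
      naturally_isomorphic D D (comp_functor G H) id_functor)"

section \<open>Null morphisms and short exact sequences\<close>

text \<open>Here \<open>Z\<close> is a set of objects of \<open>C\<close>; \<open>is_kernel C Z f k\<close> says that \<open>k\<close> is a kernel
  of \<open>f\<close>, and \<open>is_cokernel C Z f c\<close> that \<open>c\<close> is a cokernel of \<open>f\<close>.\<close>

definition null_mor :: "('o, 'm) cat \<Rightarrow> 'o set \<Rightarrow> 'm \<Rightarrow> bool" where
  "null_mor C Z f \<longleftrightarrow> f \<in> Mor C \<and>
    (\<exists>z \<in> Z. \<exists>g \<in> Hom C (Dom C f) z. \<exists>h \<in> Hom C z (Cod C f). f = Comp C h g)"

definition is_kernel :: "('o, 'm) cat \<Rightarrow> 'o set \<Rightarrow> 'm \<Rightarrow> 'm \<Rightarrow> bool" where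
  "is_kernel C Z f k \<longleftrightarrow>
    f \<in> Mor C \<and> k \<in> Mor C \<and> Cod C k = Dom C f \<and> null_mor C Z (Comp C f k) \<and>
    (\<forall>u \<in> Mor C. Cod C u = Dom C f \<and> null_mor C Z (Comp C f u) \<longrightarrow>
      (\<exists>!u'. u' \<in> Hom C (Dom C u) (Dom C k) \<and> u = Comp C k u'))"

definition is_cokernel :: "('o, 'm) cat \<Rightarrow> 'o set \<Rightarrow> 'm \<Rightarrow> 'm \<Rightarrow> bool" where
  "is_cokernel C Z f c \<longleftrightarrow>
    f \<in> Mor C \<and> c \<in> Mor C \<and> Dom C c = Cod C f \<and> null_mor C Z (Comp C c f) \<and>
    (\<forall>v \<in> Mor C. Dom C v = Cod C f \<and> null_mor C Z (Comp C v f) \<longrightarrow>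
      (\<exists>!v'. v' \<in> Hom C (Cod C c) (Cod C v) \<and> v = Comp C v' c))"

definition short_exact :: "('o, 'm) cat \<Rightarrow> 'o set \<Rightarrow> 'm \<Rightarrow> 'm \<Rightarrow> bool" where
  "short_exact C Z m e \<longleftrightarrow> is_kernel C Z e m \<and> is_cokernel C Z m e"

section \<open>Pretorsion theories\<close>

definition torsion_sequence ::
  "('o, 'm) cat \<Rightarrow> ('o, 'm) cat \<Rightarrow> ('o, 'm) cat \<Rightarrow> 'o \<Rightarrow> 'm \<times> 'm \<Rightarrow> bool" where
  "torsion_sequence C T F X = (\<lambda>(m, e).
    short_exact C (Obj T \<inter> Obj F) m e \<and> Cod C m = X \<and> Dom C m \<in> Obj T \<and> Cod C e \<in> Obj F)"

definition pretorsion_theory ::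
  "('o, 'm) cat \<Rightarrow> ('o, 'm) cat \<Rightarrow> ('o, 'm) cat \<Rightarrow> bool" where
  "pretorsion_theory C T F \<longleftrightarrow>
    full_subcategory T C \<and> replete T C \<and> full_subcategory F C \<and> replete F C \<and>
    (\<forall>A \<in> Obj T. \<forall>B \<in> Obj F. \<forall>f \<in> Hom C A B. null_mor C (Obj T \<inter> Obj F) f) \<and>
    (\<forall>X \<in> Obj C. \<exists>s. torsion_sequence C T F X s)"

text \<open>The chosen short exact sequence of every object. The choice is immaterial, since such a
  sequence is unique up to a canonical isomorphism.\<close>

definition chosen_sequence ::
  "('o, 'm) cat \<Rightarrow> ('o, 'm) cat \<Rightarrow> ('o, 'm) cat \<Rightarrow> 'o \<Rightarrow> 'm \<times> 'm" where
  "chosen_sequence C T F X = (SOME s. torsion_sequence C T F X s)"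

definition torsion_mono :: "('o, 'm) cat \<Rightarrow> ('o, 'm) cat \<Rightarrow> ('o, 'm) cat \<Rightarrow> 'o \<Rightarrow> 'm" where
  "torsion_mono C T F X = fst (chosen_sequence C T F X)"

definition torsionfree_epi :: "('o, 'm) cat \<Rightarrow> ('o, 'm) cat \<Rightarrow> ('o, 'm) cat \<Rightarrow> 'o \<Rightarrow> 'm" where
  "torsionfree_epi C T F X = snd (chosen_sequence C T F X)"

definition torsion_functor ::
  "('o, 'm) cat \<Rightarrow> ('o, 'm) cat \<Rightarrow> ('o, 'm) cat \<Rightarrow> ('o, 'm, 'o, 'm) fctr" where
  "torsion_functor C T F =
    (let m = torsion_mono C T F; t = (\<lambda>X. Dom C (m X)) in
     \<lparr>OMap = t,
      MMap = (\<lambda>g. THE h. h \<in> Hom C (t (Dom C g)) (t (Cod C g)) \<and>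
        Comp C (m (Cod C g)) h = Comp C g (m (Dom C g)))\<rparr>)"

definition torsionfree_functor ::
  "('o, 'm) cat \<Rightarrow> ('o, 'm) cat \<Rightarrow> ('o, 'm) cat \<Rightarrow> ('o, 'm, 'o, 'm) fctr" where
  "torsionfree_functor C T F =
    (let e = torsionfree_epi C T F; f = (\<lambda>X. Cod C (e X)) in
     \<lparr>OMap = f,
      MMap = (\<lambda>g. THE h. h \<in> Hom C (f (Dom C g)) (f (Cod C g)) \<and>
        Comp C h (e (Dom C g)) = Comp C (e (Cod C g)) g)\<rparr>)"

definition pair_functor ::
  "('o1, 'm1, 'o2, 'm2) fctr \<Rightarrow> ('o1, 'm1, 'o3, 'm3) fctr \<Rightarrow>
    ('o1, 'm1, 'o2 \<times> 'o3, 'm2 \<times> 'm3) fctr" where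
  "pair_functor G H =
    \<lparr>OMap = (\<lambda>X. (OMap G X, OMap H X)), MMap = (\<lambda>g. (MMap G g, MMap H g))\<rparr>"

definition thin_pretorsion_theory ::
  "('o, 'm) cat \<Rightarrow> ('o, 'm) cat \<Rightarrow> ('o, 'm) cat \<Rightarrow> bool" where
  "thin_pretorsion_theory C T F \<longleftrightarrow> pretorsion_theory C T F \<and>
    is_equivalence C (binprod_cat T F)
      (pair_functor (torsion_functor C T F) (torsionfree_functor C T F))"

end

theory Submission
  imports Defs
begin

text \<open>Kernels and cokernels in a product category are computed componentwise, hence so are torsion
  sequences. A property of the factor at index \<open>i\<close> is recovered from the product by filling the
  other coordinates with a fixed torsion sequence and its identities; this is where non-emptiness of
  all the factors is needed.

  For thinness, a componentwise comparison of the functors \<open>t\<close> and \<open>f\<close> would have to relate the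
  sequences chosen in the product to those chosen in the factors. Instead, thinness is rewritten as a
  choice-free condition that quantifies over all torsion sequences: every pair of morphisms between
  the torsion and torsion-free parts of two objects is induced by a unique morphism, and every pair
  of a torsion and a torsion-free object arises, up to isomorphism, from some object.\<close>

section \<open>Categories and equivalences\<close>

text \<open>The choice made by \<open>chosen_sequence\<close> for a family bears no relation to the
  choices made for its members, and the quasi-inverse in \<open>is_equivalence\<close> has no
  evident components on the factors. Full faithfulness together with essential surjectivity removes
  the quasi-inverse; uniqueness of torsion sequences up to isomorphism removes the choice. Full
  faithfulness then becomes a statement of unique existence, just like the kernel property, and such
  statements descend to factors without loss: the solutions in a product form the dependent product
  of the solution sets, which is a singleton exactly if every factor is. A bare uniqueness claim
  would not descend, because one empty factor makes it trivial in the product. For condition T1 the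
  other coordinates have to be filled with an object that lies in \<open>T j\<close> and in
  \<open>F j\<close> at once, since a morphism that is an identity there has equal source and
  target. T2 provides it: the composite of a short exact sequence is null, hence factors through
  such an object.\<close>

context category
begin

abbreviation comp (infixr "\<cdot>" 70) where "g \<cdot> f \<equiv> Comp C g f"

lemma Mor_Hom: "f \<in> Mor C \<Longrightarrow> f \<in> Hom C (Dom C f) (Cod C f)"
  by (simp add: Hom_def)

lemma Hom_Obj: "f \<in> Hom C A B \<Longrightarrow> A \<in> Obj C \<and> B \<in> Obj C"
  using Dom_in Cod_in by (auto simp: Hom_def)

lemma comp_Hom: "\<lbrakk>f \<in> Hom C A B; g \<in> Hom C B D\<rbrakk> \<Longrightarrow> g \<cdot> f \<in> Hom C A D"
  using Comp_in[of f g] by (auto simp: Hom_def)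

lemma comp_assoc: "\<lbrakk>f \<in> Hom C A B; g \<in> Hom C B D; h \<in> Hom C D E\<rbrakk> \<Longrightarrow> (h \<cdot> g) \<cdot> f = h \<cdot> g \<cdot> f"
  using Comp_assoc[of f g h] by (auto simp: Hom_def)

lemma id_left: "f \<in> Hom C A B \<Longrightarrow> Ident C B \<cdot> f = f"
  using Comp_Ident_left[of f] by (auto simp: Hom_def)

lemma id_right: "f \<in> Hom C A B \<Longrightarrow> f \<cdot> Ident C A = f"
  using Comp_Ident_right[of f] by (auto simp: Hom_def)

end

text \<open>Both morphisms are arguments with explicit end objects, so that an isomorphism of a
  product splits into such pairs, one for each index.\<close>

definition inverse_pair :: "('o, 'm) cat \<Rightarrow> 'o \<Rightarrow> 'o \<Rightarrow> 'm \<Rightarrow> 'm \<Rightarrow> bool" where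
  "inverse_pair C A B f g \<longleftrightarrow> f \<in> Hom C A B \<and> g \<in> Hom C B A \<and>
    Comp C g f = Ident C A \<and> Comp C f g = Ident C B"

definition isomorphic :: "('o, 'm) cat \<Rightarrow> 'o \<Rightarrow> 'o \<Rightarrow> bool" where
  "isomorphic C A B \<longleftrightarrow> (\<exists>f g. inverse_pair C A B f g)"

lemma is_iso_iff: "f \<in> Hom C A B \<Longrightarrow> is_iso C f \<longleftrightarrow> (\<exists>g. inverse_pair C A B f g)"
  by (auto simp: is_iso_def inverse_pair_def Hom_def)

text \<open>Phrases repleteness through \<open>isomorphic\<close>, which
  \<open>isomorphic_prod_cat\<close> computes componentwise.\<close>

lemma replete_iff:
  "replete S C \<longleftrightarrow> (\<forall>A B. isomorphic C A B \<and> A \<in> Obj S \<longrightarrow> B \<in> Obj S)"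
proof (intro iffI allI impI)
  fix A B assume r: "replete S C" and A: "isomorphic C A B \<and> A \<in> Obj S"
  obtain f g where fg: "inverse_pair C A B f g" using A by (auto simp: isomorphic_def)
  then have f: "f \<in> Hom C A B" by (simp add: inverse_pair_def)
  then have "is_iso C f" using is_iso_iff fg by fast
  then show "B \<in> Obj S" using r f A by (auto simp: replete_def Hom_def)
next
  assume r: "\<forall>A B. isomorphic C A B \<and> A \<in> Obj S \<longrightarrow> B \<in> Obj S"
  show "replete S C"
    unfolding replete_def
  proof (intro allI impI)
    fix f assume f: "is_iso C f \<and> Dom C f \<in> Obj S"
    then have "f \<in> Hom C (Dom C f) (Cod C f)" by (simp add: is_iso_def Hom_def)
    then have "isomorphic C (Dom C f) (Cod C f)"
      using f is_iso_iff by (fastforce simp: isomorphic_def)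
    then show "Cod C f \<in> Obj S" using r f by blast
  qed
qed

context category
begin

lemma isomorphic_refl: "A \<in> Obj C \<Longrightarrow> isomorphic C A A"
  using Ident_in id_left unfolding isomorphic_def inverse_pair_def by metis

lemma isomorphic_trans:
  assumes "isomorphic C A B" "isomorphic C B D"
  shows "isomorphic C A D"
proof -
  obtain f g where fg: "inverse_pair C A B f g"
    using assms(1) by (auto simp: isomorphic_def)
  obtain h k where hk: "inverse_pair C B D h k"
    using assms(2) by (auto simp: isomorphic_def)
  have f: "f \<in> Hom C A B" and g: "g \<in> Hom C B A" and h: "h \<in> Hom C B D" and k: "k \<in> Hom C D B"
    and inv: "g \<cdot> f = Ident C A" "f \<cdot> g = Ident C B" "k \<cdot> h = Ident C B" "h \<cdot> k = Ident C D"
    using fg hk by (auto simp: inverse_pair_def)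
  have "(g \<cdot> k) \<cdot> h \<cdot> f = Ident C A"
    using comp_assoc[OF comp_Hom[OF f h] k g] comp_assoc[OF f h k] inv id_left[OF f] by simp
  moreover have "(h \<cdot> f) \<cdot> g \<cdot> k = Ident C D"
    using comp_assoc[OF comp_Hom[OF k g] f h] comp_assoc[OF k g f] inv id_left[OF k] by simp
  ultimately have "inverse_pair C A D (h \<cdot> f) (g \<cdot> k)"
    unfolding inverse_pair_def using comp_Hom[OF f h] comp_Hom[OF k g] by simp
  then show ?thesis by (auto simp: isomorphic_def)
qed

lemma inverse_pair_cancel_right:
  assumes "inverse_pair C A B p q" "f \<in> Hom C B D" "g \<in> Hom C B D"
  shows "f \<cdot> p = g \<cdot> p \<longleftrightarrow> f = g"
proof -
  have pq: "p \<in> Hom C A B" "q \<in> Hom C B A" "p \<cdot> q = Ident C B"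
    using assms(1) by (auto simp: inverse_pair_def)
  have "(h \<cdot> p) \<cdot> q = h" if "h \<in> Hom C B D" for h
    using comp_assoc[OF pq(2,1) that] pq(3) id_right[OF that] by simp
  then show ?thesis using assms(2,3) by metis
qed

lemma inverse_pair_cancel_left:
  assumes "inverse_pair C A B p q" "f \<in> Hom C D A" "g \<in> Hom C D A"
  shows "p \<cdot> f = p \<cdot> g \<longleftrightarrow> f = g"
proof -
  have pq: "p \<in> Hom C A B" "q \<in> Hom C B A" "q \<cdot> p = Ident C A"
    using assms(1) by (auto simp: inverse_pair_def)
  have "q \<cdot> p \<cdot> h = h" if "h \<in> Hom C D A" for h
    using comp_assoc[OF that pq(1,2)] pq(3) id_left[OF that] by simp
  then show ?thesis using assms(2,3) by metis
qed

end

section \<open>Equivalences as fully faithful and essentially surjective functors\<close>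

lemma functor_Obj: "\<lbrakk>is_functor C D G; A \<in> Obj C\<rbrakk> \<Longrightarrow> OMap G A \<in> Obj D"
  by (simp add: is_functor_def)

lemma functor_Hom: "\<lbrakk>is_functor C D G; f \<in> Hom C A B\<rbrakk> \<Longrightarrow> MMap G f \<in> Hom D (OMap G A) (OMap G B)"
  by (auto simp: is_functor_def Hom_def)

lemma functor_Ident: "\<lbrakk>is_functor C D G; A \<in> Obj C\<rbrakk> \<Longrightarrow> MMap G (Ident C A) = Ident D (OMap G A)"
  by (simp add: is_functor_def)

lemma functor_Comp:
  "\<lbrakk>is_functor C D G; f \<in> Hom C A B; g \<in> Hom C B E\<rbrakk> \<Longrightarrow>
    MMap G (Comp C g f) = Comp D (MMap G g) (MMap G f)"
  by (auto simp: is_functor_def Hom_def)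

text \<open>Fullness and faithfulness as one unique existence, the form in which the condition later
  becomes \<open>unique_fillers\<close>.\<close>

definition fully_faithful ::
  "('o1, 'm1) cat \<Rightarrow> ('o2, 'm2) cat \<Rightarrow> ('o1, 'm1, 'o2, 'm2) fctr \<Rightarrow> bool" where
  "fully_faithful C D G \<longleftrightarrow> (\<forall>X \<in> Obj C. \<forall>Y \<in> Obj C. \<forall>h \<in> Hom D (OMap G X) (OMap G Y).
    \<exists>!g. g \<in> Hom C X Y \<and> MMap G g = h)"

definition essentially_surjective ::
  "('o1, 'm1) cat \<Rightarrow> ('o2, 'm2) cat \<Rightarrow> ('o1, 'm1, 'o2, 'm2) fctr \<Rightarrow> bool" where
  "essentially_surjective C D G \<longleftrightarrow> (\<forall>B \<in> Obj D. \<exists>A \<in> Obj C. isomorphic D (OMap G A) B)"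

text \<open>By naturality \<open>g \<cdot> \<eta> X = \<eta> Y \<cdot> MMap H (MMap G g)\<close>, so
  \<open>g\<close> followed back along the invertible \<open>\<eta> X\<close> depends on
  \<open>MMap G g\<close> only. With the functors exchanged, the same argument shows that
  \<open>H\<close> is faithful.\<close>

lemma naturally_isomorphic_id_cancel:
  assumes "category C" and nat: "naturally_isomorphic C C (comp_functor H G) id_functor"
    and g: "g \<in> Hom C X Y" "g' \<in> Hom C X Y" and eq: "MMap G g = MMap G g'"
  shows "g = g'"
proof -
  interpret category C by fact
  obtain \<eta> where \<eta>: "\<And>A. A \<in> Obj C \<Longrightarrow> \<eta> A \<in> Hom C (OMap H (OMap G A)) A \<and> is_iso C (\<eta> A)"
    and N: "\<And>f. f \<in> Mor C \<Longrightarrow> \<eta> (Cod C f) \<cdot> MMap H (MMap G f) = f \<cdot> \<eta> (Dom C f)"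
    using nat by (auto simp: naturally_isomorphic_def comp_functor_def id_functor_def)
  have X: "X \<in> Obj C" using g Hom_Obj by blast
  obtain k where k: "inverse_pair C (OMap H (OMap G X)) X (\<eta> X) k"
    using \<eta>[OF X] is_iso_iff by metis
  have "g \<cdot> \<eta> X = g' \<cdot> \<eta> X"
    using N[of g] N[of g'] g eq by (auto simp: Hom_def)
  then show ?thesis using inverse_pair_cancel_right[OF k g] by blast
qed

lemma equivalence_imp_fully_faithful:
  assumes C: "category C" and D: "category D" and G: "is_functor C D G" and H: "is_functor D C H"
    and GH: "naturally_isomorphic C C (comp_functor H G) id_functor"
    and HG: "naturally_isomorphic D D (comp_functor G H) id_functor"
  shows "fully_faithful C D G"
  unfolding fully_faithful_def
proof (intro ballI)
  fix X Y h assume X: "X \<in> Obj C" and Y: "Y \<in> Obj C" and h: "h \<in> Hom D (OMap G X) (OMap G Y)"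
  interpret category C by fact
  obtain \<eta> where \<eta>: "\<And>A. A \<in> Obj C \<Longrightarrow> \<eta> A \<in> Hom C (OMap H (OMap G A)) A \<and> is_iso C (\<eta> A)"
    and N: "\<And>f. f \<in> Mor C \<Longrightarrow> \<eta> (Cod C f) \<cdot> MMap H (MMap G f) = f \<cdot> \<eta> (Dom C f)"
    using GH by (auto simp: naturally_isomorphic_def comp_functor_def id_functor_def)
  obtain k where k: "inverse_pair C (OMap H (OMap G X)) X (\<eta> X) k"
    using \<eta>[OF X] is_iso_iff by metis
  obtain l where l: "inverse_pair C (OMap H (OMap G Y)) Y (\<eta> Y) l"
    using \<eta>[OF Y] is_iso_iff by metis
  note K = k[unfolded inverse_pair_def]
  have Hh: "MMap H h \<in> Hom C (OMap H (OMap G X)) (OMap H (OMap G Y))"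
    using functor_Hom[OF H h] .
  \<comment> \<open>Naturality of \<open>\<eta>\<close> forces this choice: a preimage of
    \<open>h\<close> must satisfy \<open>g \<cdot> \<eta> X = \<eta> Y \<cdot> MMap H h\<close>, and
    \<open>k\<close> inverts \<open>\<eta> X\<close>.\<close>
  define g where "g = (\<eta> Y \<cdot> MMap H h) \<cdot> k"
  have \<eta>Hh: "\<eta> Y \<cdot> MMap H h \<in> Hom C (OMap H (OMap G X)) Y"
    using comp_Hom Hh \<eta>[OF Y] by blast
  then have g: "g \<in> Hom C X Y"
    unfolding g_def using comp_Hom K by blast
  have "g \<cdot> \<eta> X = (\<eta> Y \<cdot> MMap H h) \<cdot> k \<cdot> \<eta> X"
    unfolding g_def using comp_assoc \<eta>Hh K by blast
  then have "g \<cdot> \<eta> X = \<eta> Y \<cdot> MMap H h"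
    using K id_right \<eta>Hh by metis
  moreover have "g \<cdot> \<eta> X = \<eta> Y \<cdot> MMap H (MMap G g)"
    using N[of g] g by (auto simp: Hom_def)
  ultimately have "MMap H (MMap G g) = MMap H h"
    using inverse_pair_cancel_left[OF l functor_Hom[OF H functor_Hom[OF G g]] Hh] by simp
  \<comment> \<open>This is faithfulness of \<open>H\<close>, which comes from the other natural
    isomorphism \<open>HG\<close>.\<close>
  then have "MMap G g = h"
    using naturally_isomorphic_id_cancel[OF D HG functor_Hom[OF G g] h] by simp
  then show "\<exists>!g. g \<in> Hom C X Y \<and> MMap G g = h"
    using g naturally_isomorphic_id_cancel[OF C GH] by blast
qed

text \<open>The quasi-inverse is built so that the chosen isomorphisms \<open>\<epsilon> B\<close>
  become natural. That requirement determines it on morphisms, which yields functoriality; the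
  second natural isomorphism is obtained by lifting \<open>\<epsilon>\<close> along
  \<open>G\<close>.\<close>

lemma fully_faithful_imp_equivalence:
  assumes C: "category C" and D: "category D" and G: "is_functor C D G"
    and ff: "fully_faithful C D G" and es: "essentially_surjective C D G"
  shows "is_equivalence C D G"
proof -
  interpret C: category C by fact
  interpret D: category D by fact
  have faithful: "g = g'" if "g \<in> Hom C X Y" "g' \<in> Hom C X Y" "MMap G g = MMap G g'" for g g' X Y
  proof -
    have "\<exists>!k. k \<in> Hom C X Y \<and> MMap G k = MMap G g"
      using ff functor_Hom[OF G that(1)] C.Hom_Obj[OF that(1)] unfolding fully_faithful_def by blast
    then show ?thesis using that by auto
  qed
  have full: "\<exists>g \<in> Hom C X Y. MMap G g = h"
    if "X \<in> Obj C" "Y \<in> Obj C" "h \<in> Hom D (OMap G X) (OMap G Y)" for X Y h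
    using ff that unfolding fully_faithful_def by blast
  \<comment> \<open>Object, isomorphism and inverse are chosen as one triple, so that the three
    choices belong together.\<close>
  have "\<exists>r. \<forall>B \<in> Obj D. fst (r B) \<in> Obj C \<and>
      inverse_pair D (OMap G (fst (r B))) B (fst (snd (r B))) (snd (snd (r B)))"
    using es unfolding essentially_surjective_def isomorphic_def by (intro bchoice) force
  then obtain r where r: "\<And>B. B \<in> Obj D \<Longrightarrow> fst (r B) \<in> Obj C \<and>
      inverse_pair D (OMap G (fst (r B))) B (fst (snd (r B))) (snd (snd (r B)))"
    by blast
  define H0 \<epsilon> \<delta> where "H0 = (\<lambda>B. fst (r B))" "\<epsilon> = (\<lambda>B. fst (snd (r B)))" "\<delta> = (\<lambda>B. snd (snd (r B)))"
  then have H0: "\<And>B. B \<in> Obj D \<Longrightarrow> H0 B \<in> Obj C"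
    and inv: "\<And>B. B \<in> Obj D \<Longrightarrow> inverse_pair D (OMap G (H0 B)) B (\<epsilon> B) (\<delta> B)"
    using r by auto
  have \<epsilon>: "\<epsilon> B \<in> Hom D (OMap G (H0 B)) B" and \<delta>: "\<delta> B \<in> Hom D B (OMap G (H0 B))"
    and \<delta>\<epsilon>: "Comp D (\<delta> B) (\<epsilon> B) = Ident D (OMap G (H0 B))"
    and \<epsilon>\<delta>: "Comp D (\<epsilon> B) (\<delta> B) = Ident D B" if "B \<in> Obj D" for B
    using inv[OF that] by (auto simp: inverse_pair_def)
  have "\<exists>g \<in> Hom C (H0 (Dom D h)) (H0 (Cod D h)).
      Comp D (\<epsilon> (Cod D h)) (MMap G g) = Comp D h (\<epsilon> (Dom D h))" if h: "h \<in> Mor D" for h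
  proof -
    have A: "Dom D h \<in> Obj D" and B: "Cod D h \<in> Obj D"
      using h D.Dom_in D.Cod_in by auto
    have hH: "Comp D h (\<epsilon> (Dom D h)) \<in> Hom D (OMap G (H0 (Dom D h))) (Cod D h)"
      using D.comp_Hom[OF \<epsilon>[OF A] D.Mor_Hom[OF h]] .
    \<comment> \<open>Fullness is applied to \<open>h\<close> conjugated by the chosen isomorphisms,
      the only candidate that makes \<open>\<epsilon>\<close> natural.\<close>
    obtain g where g: "g \<in> Hom C (H0 (Dom D h)) (H0 (Cod D h))"
      "MMap G g = Comp D (\<delta> (Cod D h)) (Comp D h (\<epsilon> (Dom D h)))"
      using full[OF H0[OF A] H0[OF B] D.comp_Hom[OF hH \<delta>[OF B]]] by blast
    have "Comp D (\<epsilon> (Cod D h)) (MMap G g) = Comp D h (\<epsilon> (Dom D h))"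
      using g D.comp_assoc[OF hH \<delta>[OF B] \<epsilon>[OF B]] \<epsilon>\<delta>[OF B] D.id_left[OF hH] by simp
    with g show ?thesis by blast
  qed
  then obtain H1 where H1: "\<And>h. h \<in> Mor D \<Longrightarrow> H1 h \<in> Hom C (H0 (Dom D h)) (H0 (Cod D h)) \<and>
      Comp D (\<epsilon> (Cod D h)) (MMap G (H1 h)) = Comp D h (\<epsilon> (Dom D h))"
    using bchoice[of "Mor D" "\<lambda>h g. g \<in> Hom C (H0 (Dom D h)) (H0 (Cod D h)) \<and>
      Comp D (\<epsilon> (Cod D h)) (MMap G g) = Comp D h (\<epsilon> (Dom D h))"] by blast
  have H1_Hom: "H1 h \<in> Hom C (H0 A) (H0 B)"
    and H1_nat: "Comp D (\<epsilon> B) (MMap G (H1 h)) = Comp D h (\<epsilon> A)"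
    if "h \<in> Hom D A B" for h A B
    using H1[of h] that by (auto simp: Hom_def)
  \<comment> \<open>The naturality square determines \<open>H1 h\<close>, because
    \<open>\<epsilon> B\<close> cancels and \<open>G\<close> is faithful. Each functor law below is
    proved by verifying this square.\<close>
  have H1_unique: "g = H1 h" if h: "h \<in> Hom D A B" and g: "g \<in> Hom C (H0 A) (H0 B)"
    and eq: "Comp D (\<epsilon> B) (MMap G g) = Comp D h (\<epsilon> A)" for g h A B
  proof -
    have "B \<in> Obj D" using D.Hom_Obj[OF h] by blast
    from D.inverse_pair_cancel_left[OF inv[OF this] functor_Hom[OF G g] functor_Hom[OF G H1_Hom[OF h]]]
    have "MMap G g = MMap G (H1 h)"
      using eq H1_nat[OF h] by simp
    then show ?thesis using faithful g H1_Hom[OF h] by blast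
  qed
  define H where "H = \<lparr>OMap = H0, MMap = H1\<rparr>"
  have "H1 (Ident D A) = Ident C (H0 A)" if A: "A \<in> Obj D" for A
  proof (rule H1_unique[symmetric, OF D.Ident_in[OF A] C.Ident_in[OF H0[OF A]]])
    show "Comp D (\<epsilon> A) (MMap G (Ident C (H0 A))) = Comp D (Ident D A) (\<epsilon> A)"
      using functor_Ident[OF G H0[OF A]] D.id_left[OF \<epsilon>[OF A]] D.id_right[OF \<epsilon>[OF A]] by simp
  qed
  moreover have "H1 (Comp D h' h) = Comp C (H1 h') (H1 h)"
    if h: "h \<in> Hom D A B" and h': "h' \<in> Hom D B E" for h h' A B E
  proof (rule H1_unique[symmetric, OF D.comp_Hom[OF h h'] C.comp_Hom[OF H1_Hom[OF h] H1_Hom[OF h']]])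
    have O: "A \<in> Obj D" "B \<in> Obj D" "E \<in> Obj D" using D.Hom_Obj h h' by blast+
    note GH = functor_Hom[OF G H1_Hom[OF h]] functor_Hom[OF G H1_Hom[OF h']]
    have "Comp D (\<epsilon> E) (MMap G (Comp C (H1 h') (H1 h)))
        = Comp D (Comp D (\<epsilon> E) (MMap G (H1 h'))) (MMap G (H1 h))"
      using functor_Comp[OF G H1_Hom[OF h] H1_Hom[OF h']] D.comp_assoc[OF GH \<epsilon>[OF O(3)]] by simp
    also have "\<dots> = Comp D h' (Comp D (\<epsilon> B) (MMap G (H1 h)))"
      using H1_nat[OF h'] D.comp_assoc[OF GH(1) \<epsilon>[OF O(2)] h'] by simp
    also have "\<dots> = Comp D (Comp D h' h) (\<epsilon> A)"
      using H1_nat[OF h] D.comp_assoc[OF \<epsilon>[OF O(1)] h h'] by simp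
    finally show "Comp D (\<epsilon> E) (MMap G (Comp C (H1 h') (H1 h))) = Comp D (Comp D h' h) (\<epsilon> A)" .
  qed
  ultimately have HF: "is_functor D C H"
    unfolding is_functor_def H_def using H0 H1 D.Mor_Hom by simp (metis D.Mor_Hom)
  have "is_iso D (\<epsilon> B)" if "B \<in> Obj D" for B
    using is_iso_iff[OF \<epsilon>[OF that]] inv[OF that] by blast
  then have "naturally_isomorphic D D (comp_functor G H) id_functor"
    unfolding naturally_isomorphic_def comp_functor_def id_functor_def H_def
    using \<epsilon> H1 by (intro exI[of _ \<epsilon>]) auto
  moreover have "naturally_isomorphic C C (comp_functor H G) id_functor"
  proof -
    have GO: "OMap G A \<in> Obj D" "H0 (OMap G A) \<in> Obj C" if "A \<in> Obj C" for A
      using functor_Obj[OF G that] H0 by auto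
    \<comment> \<open>The codomain of \<open>\<epsilon> (OMap G A)\<close> is
      \<open>OMap G A\<close>, so it lifts to a morphism from \<open>H0 (OMap G A)\<close> to
      \<open>A\<close>. Its inverse lifts as well, and faithfulness of \<open>G\<close> makes the
      two lifts mutually inverse.\<close>
    obtain \<eta> where \<eta>: "\<And>A. A \<in> Obj C \<Longrightarrow> \<eta> A \<in> Hom C (H0 (OMap G A)) A \<and> MMap G (\<eta> A) = \<epsilon> (OMap G A)"
      using bchoice[of "Obj C" "\<lambda>A g. g \<in> Hom C (H0 (OMap G A)) A \<and> MMap G g = \<epsilon> (OMap G A)"]
        full[OF GO(2) _ \<epsilon>[OF GO(1)]] by blast
    have "is_iso C (\<eta> A)" if A: "A \<in> Obj C" for A
    proof -
      note \<eta>A = \<eta>[OF A, THEN conjunct1] and G\<eta> = \<eta>[OF A, THEN conjunct2]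
      obtain \<theta> where \<theta>: "\<theta> \<in> Hom C A (H0 (OMap G A))" and G\<theta>: "MMap G \<theta> = \<delta> (OMap G A)"
        using full[OF A GO(2)[OF A] \<delta>[OF GO(1)[OF A]]] by blast
      have "Comp C \<theta> (\<eta> A) = Ident C (H0 (OMap G A))"
        by (rule faithful[OF C.comp_Hom[OF \<eta>A \<theta>] C.Ident_in[OF GO(2)[OF A]]])
          (simp add: functor_Comp[OF G \<eta>A \<theta>] functor_Ident[OF G GO(2)[OF A]] G\<eta> G\<theta> \<delta>\<epsilon>[OF GO(1)[OF A]])
      moreover have "Comp C (\<eta> A) \<theta> = Ident C A"
        by (rule faithful[OF C.comp_Hom[OF \<theta> \<eta>A] C.Ident_in[OF A]])
          (simp add: functor_Comp[OF G \<theta> \<eta>A] functor_Ident[OF G A] G\<eta> G\<theta> \<epsilon>\<delta>[OF GO(1)[OF A]])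
      ultimately show ?thesis
        using is_iso_iff[OF \<eta>A] \<eta>A \<theta> unfolding inverse_pair_def by blast
    qed
    moreover have "Comp C (\<eta> B) (H1 (MMap G f)) = Comp C f (\<eta> A)" if f: "f \<in> Hom C A B" for f A B
    proof -
      have A: "A \<in> Obj C" and B: "B \<in> Obj C" using C.Hom_Obj[OF f] by auto
      note Gf = functor_Hom[OF G f]
      note H1G = H1_Hom[OF Gf] and \<eta>A = \<eta>[OF A, THEN conjunct1] and \<eta>B = \<eta>[OF B, THEN conjunct1]
      show ?thesis
        by (rule faithful[OF C.comp_Hom[OF H1G \<eta>B] C.comp_Hom[OF \<eta>A f]])
          (simp add: functor_Comp[OF G H1G \<eta>B] functor_Comp[OF G \<eta>A f] \<eta>[OF A] \<eta>[OF B] H1_nat[OF Gf])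
    qed
    ultimately show ?thesis
      unfolding naturally_isomorphic_def comp_functor_def id_functor_def H_def
      using \<eta> C.Mor_Hom by (intro exI[of _ \<eta>]) simp
  qed
  ultimately show ?thesis
    unfolding is_equivalence_def using G HF by blast
qed

lemma is_equivalence_iff:
  assumes C: "category C" and D: "category D" and G: "is_functor C D G"
  shows "is_equivalence C D G \<longleftrightarrow> fully_faithful C D G \<and> essentially_surjective C D G"
proof
  assume "is_equivalence C D G"
  then obtain H where H: "is_functor D C H"
    "naturally_isomorphic C C (comp_functor H G) id_functor"
    and HG: "naturally_isomorphic D D (comp_functor G H) id_functor"
    unfolding is_equivalence_def by blast
  obtain \<epsilon> where \<epsilon>: "\<And>B. B \<in> Obj D \<Longrightarrow> \<epsilon> B \<in> Hom D (OMap G (OMap H B)) B \<and> is_iso D (\<epsilon> B)"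
    using HG by (auto simp: naturally_isomorphic_def comp_functor_def id_functor_def)
  have "isomorphic D (OMap G (OMap H B)) B" if "B \<in> Obj D" for B
    using \<epsilon>[OF that] is_iso_iff[of "\<epsilon> B" D] unfolding isomorphic_def by blast
  then have "essentially_surjective C D G"
    unfolding essentially_surjective_def using functor_Obj[OF H(1)] by blast
  then show "fully_faithful C D G \<and> essentially_surjective C D G"
    using equivalence_imp_fully_faithful[OF C D G H HG] by blast
next
  assume "fully_faithful C D G \<and> essentially_surjective C D G"
  then show "is_equivalence C D G"
    using fully_faithful_imp_equivalence[OF assms] by blast
qed

section \<open>Products of categories\<close>

text \<open>Serves to derive the description of cokernels in products from that of kernels.\<close>

definition op_cat :: "('o, 'm) cat \<Rightarrow> ('o, 'm) cat" where
  "op_cat C = \<lparr>Obj = Obj C, Mor = Mor C, Dom = Cod C, Cod = Dom C, Ident = Ident C,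
    Comp = (\<lambda>g f. Comp C f g)\<rparr>"

lemma op_cat_simps [simp]:
  "Obj (op_cat C) = Obj C" "Mor (op_cat C) = Mor C" "Dom (op_cat C) = Cod C"
  "Cod (op_cat C) = Dom C" "Ident (op_cat C) = Ident C" "Comp (op_cat C) g f = Comp C f g"
  "Hom (op_cat C) A B = Hom C B A"
  by (auto simp: op_cat_def Hom_def)

lemma null_mor_op_cat: "null_mor (op_cat C) Z f \<longleftrightarrow> null_mor C Z f"
  unfolding null_mor_def op_cat_simps by blast

lemma is_cokernel_iff_kernel_op: "is_cokernel C Z f c \<longleftrightarrow> is_kernel (op_cat C) Z f c"
  by (simp add: is_cokernel_def is_kernel_def null_mor_op_cat)

lemma prod_cat_simps [simp]:
  "Obj (prod_cat I C) = (\<Pi>\<^sub>E i\<in>I. Obj (C i))" "Mor (prod_cat I C) = (\<Pi>\<^sub>E i\<in>I. Mor (C i))"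
  "Dom (prod_cat I C) f = (\<lambda>i\<in>I. Dom (C i) (f i))" "Cod (prod_cat I C) f = (\<lambda>i\<in>I. Cod (C i) (f i))"
  "Ident (prod_cat I C) A = (\<lambda>i\<in>I. Ident (C i) (A i))"
  "Comp (prod_cat I C) g f = (\<lambda>i\<in>I. Comp (C i) (g i) (f i))"
  by (auto simp: prod_cat_def)

lemma op_cat_prod_cat: "op_cat (prod_cat I C) = prod_cat I (\<lambda>i. op_cat (C i))"
  by (simp add: op_cat_def prod_cat_def)

lemma restrict_eq_iff: "restrict f I = g \<longleftrightarrow> g \<in> extensional I \<and> (\<forall>i\<in>I. f i = g i)"
  by (auto simp: extensional_def restrict_def fun_eq_iff)

lemma eq_restrict_iff: "g = restrict f I \<longleftrightarrow> g \<in> extensional I \<and> (\<forall>i\<in>I. g i = f i)"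
  using restrict_eq_iff[of f I g] by auto

text \<open>The end objects must be extensional because domain and codomain in the product are
  restricted functions.\<close>

lemma Hom_prod_cat:
  "f \<in> Hom (prod_cat I C) A B \<longleftrightarrow> A \<in> extensional I \<and> B \<in> extensional I \<and>
    f \<in> (\<Pi>\<^sub>E i\<in>I. Hom (C i) (A i) (B i))"
  unfolding Hom_def prod_cat_simps mem_Collect_eq restrict_eq_iff PiE_iff by blast

lemma category_prod_cat:
  assumes "\<And>i. i \<in> I \<Longrightarrow> category (C i)"
  shows "category (prod_cat I C)"
proof
  fix f assume f: "f \<in> Mor (prod_cat I C)"
  show "Dom (prod_cat I C) f \<in> Obj (prod_cat I C)" "Cod (prod_cat I C) f \<in> Obj (prod_cat I C)"
    using f assms by (auto simp: PiE_iff category.Dom_in category.Cod_in)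
  show "Comp (prod_cat I C) (Ident (prod_cat I C) (Cod (prod_cat I C) f)) f = f"
    "Comp (prod_cat I C) f (Ident (prod_cat I C) (Dom (prod_cat I C) f)) = f"
    using f assms by (auto simp: restrict_eq_iff PiE_iff category.Comp_Ident_left category.Comp_Ident_right)
  fix g assume g: "g \<in> Mor (prod_cat I C)" "Dom (prod_cat I C) g = Cod (prod_cat I C) f"
  show "Comp (prod_cat I C) g f \<in> Hom (prod_cat I C) (Dom (prod_cat I C) f) (Cod (prod_cat I C) g)"
    using f g assms by (auto simp: restrict_eq_iff PiE_iff Hom_prod_cat category.Comp_in)
  fix h assume h: "h \<in> Mor (prod_cat I C)" "Dom (prod_cat I C) h = Cod (prod_cat I C) g"
  show "Comp (prod_cat I C) h (Comp (prod_cat I C) g f) = Comp (prod_cat I C) (Comp (prod_cat I C) h g) f"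
    using f g h assms by (auto simp: restrict_eq_iff PiE_iff category.Comp_assoc)
next
  fix A assume "A \<in> Obj (prod_cat I C)"
  then show "Ident (prod_cat I C) A \<in> Hom (prod_cat I C) A A"
    using assms by (auto simp: PiE_iff Hom_prod_cat category.Ident_in)
qed

lemma subcategory_prod_cat:
  assumes "\<And>i. i \<in> I \<Longrightarrow> subcategory (S i) (C i)"
  shows "subcategory (prod_cat I S) (prod_cat I C)"
proof -
  have cat: "category (S i)" "category (C i)" if "i \<in> I" for i
    using assms[OF that] by (auto simp: subcategory_def)
  have "subcategory_axioms (prod_cat I S) (prod_cat I C)"
  proof
    show "Obj (prod_cat I S) \<subseteq> Obj (prod_cat I C)" "Mor (prod_cat I S) \<subseteq> Mor (prod_cat I C)"
      using assms by (auto simp: PiE_iff dest: subcategory.Obj_sub subcategory.Mor_sub)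
  next
    fix f g assume f: "f \<in> Mor (prod_cat I S)" and g: "g \<in> Mor (prod_cat I S)"
      "Dom (prod_cat I S) g = Cod (prod_cat I S) f"
    then show "Comp (prod_cat I S) g f = Comp (prod_cat I C) g f"
      using assms by (auto simp: restrict_eq_iff PiE_iff subcategory.Comp_sub)
  qed (use assms in \<open>auto simp: restrict_eq_iff PiE_iff subcategory.Dom_sub subcategory.Cod_sub
        subcategory.Ident_sub\<close>)
  then show ?thesis
    using cat by (simp add: subcategory_def category_prod_cat)
qed

text \<open>A dependent product is a singleton exactly if each factor is one. Kernel lifts and
  fillers are transferred through this in both directions: a unique solution in the product already
  guarantees that no factor of the solution set is empty.\<close>

lemma ex1_PiE_iff: "(\<exists>!f. f \<in> (\<Pi>\<^sub>E i\<in>I. P i)) \<longleftrightarrow> (\<forall>i\<in>I. \<exists>!x. x \<in> P i)"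
proof -
  have ex1: "(\<exists>!x. x \<in> S) \<longleftrightarrow> (\<exists>x. S = {x})" for S :: "'c set" by auto
  show ?thesis
  proof
    assume "\<exists>!f. f \<in> Pi\<^sub>E I P"
    then obtain f where f: "Pi\<^sub>E I P = {f}" by (auto simp: ex1)
    then have "f \<in> Pi\<^sub>E I P" by simp
    then have "restrict f I = f" by (auto simp: PiE_iff extensional_restrict)
    then have "\<forall>i\<in>I. P i = {f i}" using f PiE_eq_singleton[of I P f] by simp
    then show "\<forall>i\<in>I. \<exists>!x. x \<in> P i" by auto
  next
    assume "\<forall>i\<in>I. \<exists>!x. x \<in> P i"
    then have "\<exists>f. \<forall>i\<in>I. P i = {f i}" unfolding ex1 by (rule bchoice)
    then obtain f where "\<forall>i\<in>I. P i = {f i}" ..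
    then have "Pi\<^sub>E I P = {restrict f I}" using PiE_eq_singleton[of I P f] by simp
    then show "\<exists>!f. f \<in> Pi\<^sub>E I P" by simp
  qed
qed

lemma PiE_update: "\<lbrakk>f \<in> (\<Pi>\<^sub>E j\<in>I. A j); i \<in> I; x \<in> A i\<rbrakk> \<Longrightarrow> f(i := x) \<in> (\<Pi>\<^sub>E j\<in>I. A j)"
  by (auto simp: PiE_iff extensional_def)

lemma null_mor_prod_cat:
  "null_mor (prod_cat I C) (\<Pi>\<^sub>E i\<in>I. Z i) f \<longleftrightarrow>
    f \<in> extensional I \<and> (\<forall>i\<in>I. null_mor (C i) (Z i) (f i))"
proof
  assume "null_mor (prod_cat I C) (\<Pi>\<^sub>E i\<in>I. Z i) f"
  then obtain z g h where "z \<in> (\<Pi>\<^sub>E i\<in>I. Z i)" "g \<in> Hom (prod_cat I C) (Dom (prod_cat I C) f) z"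
    "h \<in> Hom (prod_cat I C) z (Cod (prod_cat I C) f)" "f = Comp (prod_cat I C) h g"
    "f \<in> Mor (prod_cat I C)"
    unfolding null_mor_def by blast
  then show "f \<in> extensional I \<and> (\<forall>i\<in>I. null_mor (C i) (Z i) (f i))"
    unfolding null_mor_def eq_restrict_iff Hom_prod_cat prod_cat_simps by (fastforce simp: PiE_iff)
next
  assume f: "f \<in> extensional I \<and> (\<forall>i\<in>I. null_mor (C i) (Z i) (f i))"
  \<comment> \<open>A factorization is chosen at every index, with its object and both morphisms
    packed into one triple.\<close>
  then have "\<forall>i\<in>I. \<exists>r. fst r \<in> Z i \<and> fst (snd r) \<in> Hom (C i) (Dom (C i) (f i)) (fst r) \<and>
      snd (snd r) \<in> Hom (C i) (fst r) (Cod (C i) (f i)) \<and> f i = Comp (C i) (snd (snd r)) (fst (snd r))"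
    unfolding null_mor_def by force
  from bchoice[OF this] obtain r where
    rz: "\<And>i. i \<in> I \<Longrightarrow> fst (r i) \<in> Z i"
    and rg: "\<And>i. i \<in> I \<Longrightarrow> fst (snd (r i)) \<in> Hom (C i) (Dom (C i) (f i)) (fst (r i))"
    and rh: "\<And>i. i \<in> I \<Longrightarrow> snd (snd (r i)) \<in> Hom (C i) (fst (r i)) (Cod (C i) (f i))"
    and r: "\<And>i. i \<in> I \<Longrightarrow> f i = Comp (C i) (snd (snd (r i))) (fst (snd (r i)))"
    by blast
  show "null_mor (prod_cat I C) (\<Pi>\<^sub>E i\<in>I. Z i) f"
    unfolding null_mor_def
  proof (intro conjI bexI)
    show "f \<in> Mor (prod_cat I C)" using f by (auto simp: PiE_iff null_mor_def)
    show "(\<lambda>i\<in>I. fst (r i)) \<in> (\<Pi>\<^sub>E i\<in>I. Z i)" using rz by auto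
    show "(\<lambda>i\<in>I. fst (snd (r i))) \<in> Hom (prod_cat I C) (Dom (prod_cat I C) f) (\<lambda>i\<in>I. fst (r i))"
      "(\<lambda>i\<in>I. snd (snd (r i))) \<in> Hom (prod_cat I C) (\<lambda>i\<in>I. fst (r i)) (Cod (prod_cat I C) f)"
      using rg rh by (auto simp: Hom_prod_cat)
    show "f = Comp (prod_cat I C) (\<lambda>i\<in>I. snd (snd (r i))) (\<lambda>i\<in>I. fst (snd (r i)))"
      using f r by (auto simp: eq_restrict_iff)
  qed
qed

text \<open>Brings the lifts of \<open>u\<close> through \<open>k\<close> into the form of a
  dependent product, so that \<open>ex1_PiE_iff\<close> applies to them.\<close>

lemma kernel_lifts_prod_cat:
  assumes "u \<in> extensional I"
  shows "u' \<in> Hom (prod_cat I C) (Dom (prod_cat I C) u) (Dom (prod_cat I C) k) \<and>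
      u = Comp (prod_cat I C) k u' \<longleftrightarrow>
    u' \<in> (\<Pi>\<^sub>E i\<in>I. {x. x \<in> Hom (C i) (Dom (C i) (u i)) (Dom (C i) (k i)) \<and> u i = Comp (C i) (k i) x})"
  using assms by (auto simp: Hom_prod_cat eq_restrict_iff PiE_iff)

text \<open>The mapping property at a single index is tested on the morphism that agrees with the kernel
  itself at all other indices.\<close>

lemma is_kernel_prod_cat:
  "is_kernel (prod_cat I C) (\<Pi>\<^sub>E i\<in>I. Z i) f k \<longleftrightarrow>
    f \<in> extensional I \<and> k \<in> extensional I \<and> (\<forall>i\<in>I. is_kernel (C i) (Z i) (f i) (k i))"
proof
  assume ker: "is_kernel (prod_cat I C) (\<Pi>\<^sub>E i\<in>I. Z i) f k"
  then have f: "f \<in> (\<Pi>\<^sub>E i\<in>I. Mor (C i))" and k: "k \<in> (\<Pi>\<^sub>E i\<in>I. Mor (C i))"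
    and comp: "\<And>i. i \<in> I \<Longrightarrow> Cod (C i) (k i) = Dom (C i) (f i)"
    and null: "\<And>i. i \<in> I \<Longrightarrow> null_mor (C i) (Z i) (Comp (C i) (f i) (k i))"
    by (auto simp: is_kernel_def null_mor_prod_cat restrict_eq_iff)
  have "\<exists>!u'. u' \<in> Hom (C i) (Dom (C i) u) (Dom (C i) (k i)) \<and> u = Comp (C i) (k i) u'"
    if i: "i \<in> I" and u: "u \<in> Mor (C i)" "Cod (C i) u = Dom (C i) (f i)"
      "null_mor (C i) (Z i) (Comp (C i) (f i) u)" for i u
  proof -
    define v where "v = k(i := u)"
    have v: "v \<in> (\<Pi>\<^sub>E i\<in>I. Mor (C i))" unfolding v_def using PiE_update[OF k i] u(1) .
    then have ext: "v \<in> extensional I" by (simp add: PiE_iff)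
    have "Cod (prod_cat I C) v = Dom (prod_cat I C) f"
      using comp u by (auto simp: v_def restrict_eq_iff)
    moreover have "null_mor (prod_cat I C) (\<Pi>\<^sub>E i\<in>I. Z i) (Comp (prod_cat I C) f v)"
      using null u by (auto simp: v_def null_mor_prod_cat)
    ultimately have "\<exists>!u'. u' \<in> Hom (prod_cat I C) (Dom (prod_cat I C) v) (Dom (prod_cat I C) k) \<and>
        v = Comp (prod_cat I C) k u'"
      using ker v unfolding is_kernel_def prod_cat_simps(2) by blast
    then have "\<forall>j\<in>I. \<exists>!u'. u' \<in> {x. x \<in> Hom (C j) (Dom (C j) (v j)) (Dom (C j) (k j)) \<and>
        v j = Comp (C j) (k j) x}"
      unfolding kernel_lifts_prod_cat[OF ext] ex1_PiE_iff .
    from bspec[OF this i] show ?thesis by (simp add: v_def)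
  qed
  moreover have "f i \<in> Mor (C i)" "k i \<in> Mor (C i)" if "i \<in> I" for i
    using f k that by auto
  ultimately have "is_kernel (C i) (Z i) (f i) (k i)" if "i \<in> I" for i
    unfolding is_kernel_def using comp null that by blast
  then show "f \<in> extensional I \<and> k \<in> extensional I \<and> (\<forall>i\<in>I. is_kernel (C i) (Z i) (f i) (k i))"
    using f k by (simp add: PiE_iff)
next
  assume R: "f \<in> extensional I \<and> k \<in> extensional I \<and> (\<forall>i\<in>I. is_kernel (C i) (Z i) (f i) (k i))"
  have "\<exists>!u'. u' \<in> Hom (prod_cat I C) (Dom (prod_cat I C) u) (Dom (prod_cat I C) k) \<and>
        u = Comp (prod_cat I C) k u'"
    if u: "u \<in> Mor (prod_cat I C)" "Cod (prod_cat I C) u = Dom (prod_cat I C) f"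
      "null_mor (prod_cat I C) (\<Pi>\<^sub>E i\<in>I. Z i) (Comp (prod_cat I C) f u)" for u
  proof -
    have ext: "u \<in> extensional I" using u by (simp add: PiE_iff)
    have "\<exists>!u'. u' \<in> {x. x \<in> Hom (C i) (Dom (C i) (u i)) (Dom (C i) (k i)) \<and> u i = Comp (C i) (k i) x}"
      if i: "i \<in> I" for i
    proof -
      have "u i \<in> Mor (C i)" "Cod (C i) (u i) = Dom (C i) (f i)"
        "null_mor (C i) (Z i) (Comp (C i) (f i) (u i))"
        using u i by (auto simp: restrict_eq_iff null_mor_prod_cat)
      then show ?thesis using R i unfolding is_kernel_def mem_Collect_eq by blast
    qed
    then show ?thesis unfolding kernel_lifts_prod_cat[OF ext] ex1_PiE_iff by blast
  qed
  moreover have "f \<in> Mor (prod_cat I C)" "k \<in> Mor (prod_cat I C)"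
    "Cod (prod_cat I C) k = Dom (prod_cat I C) f"
    "null_mor (prod_cat I C) (\<Pi>\<^sub>E i\<in>I. Z i) (Comp (prod_cat I C) f k)"
    using R by (auto simp: is_kernel_def PiE_iff restrict_eq_iff null_mor_prod_cat)
  ultimately show "is_kernel (prod_cat I C) (\<Pi>\<^sub>E i\<in>I. Z i) f k"
    unfolding is_kernel_def by blast
qed

text \<open>Follows by duality: the opposite of a product is the product of the opposites, and null
  morphisms are self-dual.\<close>

lemma is_cokernel_prod_cat:
  "is_cokernel (prod_cat I C) (\<Pi>\<^sub>E i\<in>I. Z i) f c \<longleftrightarrow>
    f \<in> extensional I \<and> c \<in> extensional I \<and> (\<forall>i\<in>I. is_cokernel (C i) (Z i) (f i) (c i))"
  by (simp add: is_cokernel_iff_kernel_op op_cat_prod_cat is_kernel_prod_cat)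

text \<open>By \<open>PiE_Int\<close> the objects common to both product subcategories are the
  families in \<open>Obj (T i) \<inter> Obj (F i)\<close>, so the kernels and cokernels on both
  sides refer to matching null morphisms.\<close>

lemma torsion_sequence_prod_cat:
  "torsion_sequence (prod_cat I C) (prod_cat I T) (prod_cat I F) X (m, e) \<longleftrightarrow>
    X \<in> extensional I \<and> m \<in> extensional I \<and> e \<in> extensional I \<and>
    (\<forall>i\<in>I. torsion_sequence (C i) (T i) (F i) (X i) (m i, e i))"
  by (auto simp: torsion_sequence_def short_exact_def PiE_Int is_kernel_prod_cat is_cokernel_prod_cat
      restrict_eq_iff PiE_iff)

lemma isomorphic_prod_cat:
  "isomorphic (prod_cat I C) A B \<longleftrightarrow>
    A \<in> extensional I \<and> B \<in> extensional I \<and> (\<forall>i\<in>I. isomorphic (C i) (A i) (B i))"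
proof
  assume "isomorphic (prod_cat I C) A B"
  then obtain f g where "inverse_pair (prod_cat I C) A B f g"
    unfolding isomorphic_def by blast
  then have "A \<in> extensional I \<and> B \<in> extensional I \<and> (\<forall>i\<in>I. inverse_pair (C i) (A i) (B i) (f i) (g i))"
    by (auto simp: inverse_pair_def Hom_prod_cat restrict_eq_iff PiE_iff)
  then show "A \<in> extensional I \<and> B \<in> extensional I \<and> (\<forall>i\<in>I. isomorphic (C i) (A i) (B i))"
    unfolding isomorphic_def by blast
next
  assume R: "A \<in> extensional I \<and> B \<in> extensional I \<and> (\<forall>i\<in>I. isomorphic (C i) (A i) (B i))"
  then have "\<forall>i\<in>I. \<exists>r. inverse_pair (C i) (A i) (B i) (fst r) (snd r)"
    unfolding isomorphic_def by force
  from bchoice[OF this] obtain r where "\<forall>i\<in>I. inverse_pair (C i) (A i) (B i) (fst (r i)) (snd (r i))"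
    by blast
  then have "inverse_pair (prod_cat I C) A B (\<lambda>i\<in>I. fst (r i)) (\<lambda>i\<in>I. snd (r i))"
    using R by (auto simp: inverse_pair_def Hom_prod_cat restrict_eq_iff)
  then show "isomorphic (prod_cat I C) A B"
    unfolding isomorphic_def by blast
qed

section \<open>Pretorsion theories in products\<close>

lemma PiE_updateD: "\<lbrakk>f(i := x) \<in> (\<Pi>\<^sub>E j\<in>I. A j); i \<in> I\<rbrakk> \<Longrightarrow> x \<in> A i"
  by (drule PiE_mem) auto

text \<open>Embeds a morphism of one factor into the product; identities elsewhere keep the
  remaining coordinates of source and target equal to those of \<open>A\<close>.\<close>

lemma Hom_prod_cat_update:
  assumes "\<And>j. j \<in> I \<Longrightarrow> category (C j)" and "A \<in> (\<Pi>\<^sub>E j\<in>I. Obj (C j))" and "i \<in> I"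
    and "g \<in> Hom (C i) X Y"
  shows "(\<lambda>j\<in>I. Ident (C j) (A j))(i := g) \<in> Hom (prod_cat I C) (A(i := X)) (A(i := Y))"
  using assms by (auto simp: Hom_prod_cat PiE_iff extensional_def category.Ident_in)

lemma isomorphic_prod_cat_update:
  assumes "\<And>j. j \<in> I \<Longrightarrow> category (C j)" and "A \<in> (\<Pi>\<^sub>E j\<in>I. Obj (C j))" and "i \<in> I"
    and "isomorphic (C i) X Y"
  shows "isomorphic (prod_cat I C) (A(i := X)) (A(i := Y))"
  using assms by (auto simp: isomorphic_prod_cat PiE_iff extensional_def category.isomorphic_refl)

section \<open>Fullness and repleteness of product subcategories and of their factors\<close>

context
  fixes I :: "'i set" and C S :: "'i \<Rightarrow> ('o, 'm) cat"
  assumes sub: "\<And>i. i \<in> I \<Longrightarrow> subcategory (S i) (C i)"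
begin

lemma subcategory_categories: "i \<in> I \<Longrightarrow> category (C i)"
  using sub by (simp add: subcategory_def)

lemma Obj_prod_subset: "A \<in> (\<Pi>\<^sub>E i\<in>I. Obj (S i)) \<Longrightarrow> A \<in> (\<Pi>\<^sub>E i\<in>I. Obj (C i))"
  using sub by (auto simp: PiE_iff dest: subcategory.Obj_sub)

lemma full_subcategory_prod_catI:
  assumes "\<And>i. i \<in> I \<Longrightarrow> full_subcategory (S i) (C i)"
  shows "full_subcategory (prod_cat I S) (prod_cat I C)"
  unfolding full_subcategory_def
proof (intro conjI ballI subsetI)
  show "subcategory (prod_cat I S) (prod_cat I C)" using subcategory_prod_cat sub by blast
  fix A B f assume "A \<in> Obj (prod_cat I S)" "B \<in> Obj (prod_cat I S)" "f \<in> Hom (prod_cat I C) A B"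
  then have "f \<in> extensional I"
    "\<And>i. i \<in> I \<Longrightarrow> A i \<in> Obj (S i) \<and> B i \<in> Obj (S i) \<and> f i \<in> Hom (C i) (A i) (B i)"
    by (auto simp: Hom_prod_cat PiE_iff)
  then show "f \<in> Mor (prod_cat I S)"
    using assms unfolding full_subcategory_def prod_cat_simps PiE_iff by blast
qed

text \<open>The family \<open>A\<close> supplies objects of the subcategories at the remaining
  indices. Padding \<open>g\<close> with their identities gives a morphism between objects of the
  product subcategory, and its membership there is read off at \<open>i\<close>.\<close>

lemma full_subcategory_prod_catD:
  assumes full: "full_subcategory (prod_cat I S) (prod_cat I C)"
    and A: "A \<in> (\<Pi>\<^sub>E i\<in>I. Obj (S i))" and i: "i \<in> I"
  shows "full_subcategory (S i) (C i)"
  unfolding full_subcategory_def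
proof (intro conjI ballI subsetI)
  show "subcategory (S i) (C i)" using sub i by blast
  fix X Y g assume X: "X \<in> Obj (S i)" and Y: "Y \<in> Obj (S i)" and g: "g \<in> Hom (C i) X Y"
  have "(\<lambda>j\<in>I. Ident (C j) (A j))(i := g) \<in> Mor (prod_cat I S)"
    using full Hom_prod_cat_update[OF subcategory_categories Obj_prod_subset[OF A] i g]
      PiE_update[OF A i X] PiE_update[OF A i Y]
    unfolding full_subcategory_def prod_cat_simps(1) by blast
  then show "g \<in> Mor (S i)" unfolding prod_cat_simps using PiE_updateD i by fast
qed

lemma replete_prod_catI:
  assumes "\<And>i. i \<in> I \<Longrightarrow> replete (S i) (C i)"
  shows "replete (prod_cat I S) (prod_cat I C)"
  using assms unfolding replete_iff isomorphic_prod_cat prod_cat_simps PiE_iff by blast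

lemma replete_prod_catD:
  assumes r: "replete (prod_cat I S) (prod_cat I C)"
    and A: "A \<in> (\<Pi>\<^sub>E i\<in>I. Obj (S i))" and i: "i \<in> I"
  shows "replete (S i) (C i)"
  unfolding replete_iff
proof (intro allI impI)
  fix X Y assume X: "isomorphic (C i) X Y \<and> X \<in> Obj (S i)"
  then have "A(i := X) \<in> Obj (prod_cat I S)"
    using PiE_update[OF A i] by simp
  moreover have "isomorphic (prod_cat I C) (A(i := X)) (A(i := Y))"
    using isomorphic_prod_cat_update[OF subcategory_categories Obj_prod_subset[OF A] i] X by blast
  ultimately have "A(i := Y) \<in> Obj (prod_cat I S)"
    using r unfolding replete_iff by blast
  then show "Y \<in> Obj (S i)" unfolding prod_cat_simps using PiE_updateD i by fast
qed

end

section \<open>The axioms of a pretorsion theory in the product and in the factors\<close>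

context
  fixes I :: "'i set" and C T F :: "'i \<Rightarrow> ('o, 'm) cat"
  assumes subT: "\<And>i. i \<in> I \<Longrightarrow> subcategory (T i) (C i)"
    and subF: "\<And>i. i \<in> I \<Longrightarrow> subcategory (F i) (C i)"
begin

lemma pretorsion_theory_prod_catI:
  assumes pt: "\<And>i. i \<in> I \<Longrightarrow> pretorsion_theory (C i) (T i) (F i)"
  shows "pretorsion_theory (prod_cat I C) (prod_cat I T) (prod_cat I F)"
  unfolding pretorsion_theory_def
proof (intro conjI ballI)
  show "full_subcategory (prod_cat I T) (prod_cat I C)" "full_subcategory (prod_cat I F) (prod_cat I C)"
    using pt by (auto simp: pretorsion_theory_def intro!: full_subcategory_prod_catI subT subF)
  show "replete (prod_cat I T) (prod_cat I C)" "replete (prod_cat I F) (prod_cat I C)"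
    using pt by (auto simp: pretorsion_theory_def intro!: replete_prod_catI subT subF)
next
  fix A B f assume "A \<in> Obj (prod_cat I T)" "B \<in> Obj (prod_cat I F)" "f \<in> Hom (prod_cat I C) A B"
  then have "f \<in> extensional I"
    "\<And>i. i \<in> I \<Longrightarrow> A i \<in> Obj (T i) \<and> B i \<in> Obj (F i) \<and> f i \<in> Hom (C i) (A i) (B i)"
    by (auto simp: Hom_prod_cat PiE_iff)
  then show "null_mor (prod_cat I C) (Obj (prod_cat I T) \<inter> Obj (prod_cat I F)) f"
    using pt unfolding pretorsion_theory_def prod_cat_simps PiE_Int null_mor_prod_cat by blast
next
  fix X assume X: "X \<in> Obj (prod_cat I C)"
  then have "\<exists>s. torsion_sequence (C i) (T i) (F i) (X i) s" if "i \<in> I" for i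
    using pt[OF that] that unfolding pretorsion_theory_def prod_cat_simps by (meson PiE_mem)
  then obtain s where s: "\<And>i. i \<in> I \<Longrightarrow> torsion_sequence (C i) (T i) (F i) (X i) (s i)"
    using bchoice[of I "\<lambda>i. torsion_sequence (C i) (T i) (F i) (X i)"] by blast
  have "torsion_sequence (prod_cat I C) (prod_cat I T) (prod_cat I F) X (\<lambda>i\<in>I. fst (s i), \<lambda>i\<in>I. snd (s i))"
    using s X by (auto simp: torsion_sequence_prod_cat PiE_iff)
  then show "\<exists>s. torsion_sequence (prod_cat I C) (prod_cat I T) (prod_cat I F) X s" by blast
qed

lemma pretorsion_theory_prod_catD:
  assumes pt: "pretorsion_theory (prod_cat I C) (prod_cat I T) (prod_cat I F)"
    and ne: "\<And>i. i \<in> I \<Longrightarrow> Obj (C i) \<noteq> {}" and i: "i \<in> I"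
  shows "pretorsion_theory (C i) (T i) (F i)"
proof -
  have cat: "\<And>j. j \<in> I \<Longrightarrow> category (C j)"
    using subT by (simp add: subcategory_def)
  have full: "full_subcategory (prod_cat I T) (prod_cat I C)" "full_subcategory (prod_cat I F) (prod_cat I C)"
    and repl: "replete (prod_cat I T) (prod_cat I C)" "replete (prod_cat I F) (prod_cat I C)"
    and T1: "\<And>A B f. \<lbrakk>A \<in> Obj (prod_cat I T); B \<in> Obj (prod_cat I F); f \<in> Hom (prod_cat I C) A B\<rbrakk> \<Longrightarrow>
      null_mor (prod_cat I C) (Obj (prod_cat I T) \<inter> Obj (prod_cat I F)) f"
    and T2: "\<And>X. X \<in> Obj (prod_cat I C) \<Longrightarrow>
      \<exists>m e. torsion_sequence (prod_cat I C) (prod_cat I T) (prod_cat I F) X (m, e)"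
    using pt unfolding pretorsion_theory_def by auto
  \<comment> \<open>A product of non-empty sets is non-empty, by the axiom of choice.\<close>
  obtain X where X: "X \<in> (\<Pi>\<^sub>E i\<in>I. Obj (C i))"
    using ne PiE_eq_empty_iff[of I "\<lambda>i. Obj (C i)"] by blast
  then obtain m e where me: "torsion_sequence (prod_cat I C) (prod_cat I T) (prod_cat I F) X (m, e)"
    using T2 unfolding prod_cat_simps by blast
  \<comment> \<open>This null composite factors through an object \<open>z\<close> of both product
    subcategories, which can fill the other coordinates for \<open>T\<close> and for
    \<open>F\<close> alike.\<close>
  then have "null_mor (prod_cat I C) (Obj (prod_cat I T) \<inter> Obj (prod_cat I F)) (Comp (prod_cat I C) e m)"
    by (simp add: torsion_sequence_def short_exact_def is_kernel_def)
  then obtain z where z: "z \<in> Obj (prod_cat I T)" "z \<in> Obj (prod_cat I F)"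
    unfolding null_mor_def by blast
  then have z: "z \<in> (\<Pi>\<^sub>E i\<in>I. Obj (T i))" "z \<in> (\<Pi>\<^sub>E i\<in>I. Obj (F i))"
    unfolding prod_cat_simps by auto
  show ?thesis
    unfolding pretorsion_theory_def
  proof (intro conjI ballI)
    show "full_subcategory (T i) (C i)" "full_subcategory (F i) (C i)"
      using full_subcategory_prod_catD[OF subT full(1) z(1) i] full_subcategory_prod_catD[OF subF full(2) z(2) i]
      by blast+
    show "replete (T i) (C i)" "replete (F i) (C i)"
      using replete_prod_catD[OF subT repl(1) z(1) i] replete_prod_catD[OF subF repl(2) z(2) i] by blast+
  next
    fix A B f assume A: "A \<in> Obj (T i)" and B: "B \<in> Obj (F i)" and f: "f \<in> Hom (C i) A B"
    \<comment> \<open>Away from \<open>i\<close> the two objects coincide, so \<open>f\<close>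
      padded with identities is a morphism from a torsion to a torsion-free object of the
      product.\<close>
    have "z(i := A) \<in> Obj (prod_cat I T)" "z(i := B) \<in> Obj (prod_cat I F)"
      using PiE_update[OF z(1) i A] PiE_update[OF z(2) i B] by auto
    from T1[OF this Hom_prod_cat_update[OF cat Obj_prod_subset[OF subT z(1)] i f]]
    have "null_mor (C i) (Obj (T i) \<inter> Obj (F i)) (((\<lambda>j\<in>I. Ident (C j) (z j))(i := f)) i)"
      unfolding prod_cat_simps PiE_Int null_mor_prod_cat using i by blast
    then show "null_mor (C i) (Obj (T i) \<inter> Obj (F i)) f" by simp
  next
    fix A assume A: "A \<in> Obj (C i)"
    obtain m e where "torsion_sequence (prod_cat I C) (prod_cat I T) (prod_cat I F) (X(i := A)) (m, e)"
      using T2 PiE_update[OF X i A] unfolding prod_cat_simps by blast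
    then have "torsion_sequence (C i) (T i) (F i) A (m i, e i)"
      unfolding torsion_sequence_prod_cat using i by (metis fun_upd_same)
    then show "\<exists>s. torsion_sequence (C i) (T i) (F i) A s" by blast
  qed
qed

end

section \<open>Thinness without choices\<close>

lemma binprod_cat_simps [simp]:
  "Obj (binprod_cat C D) = Obj C \<times> Obj D"
  "Mor (binprod_cat C D) = Mor C \<times> Mor D"
  "Dom (binprod_cat C D) (f, f') = (Dom C f, Dom D f')"
  "Cod (binprod_cat C D) (f, f') = (Cod C f, Cod D f')"
  "Ident (binprod_cat C D) (A, B) = (Ident C A, Ident D B)"
  "Comp (binprod_cat C D) (g, g') (f, f') = (Comp C g f, Comp D g' f')"
  by (auto simp: binprod_cat_def)

lemma Hom_binprod_cat [simp]: "Hom (binprod_cat C D) (A, B) (A', B') = Hom C A A' \<times> Hom D B B'"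
  unfolding Hom_def by auto

lemma category_binprod_cat:
  assumes "category C" "category D"
  shows "category (binprod_cat C D)"
proof -
  interpret C: category C by fact
  interpret D: category D by fact
  show ?thesis
  proof
    fix f assume "f \<in> Mor (binprod_cat C D)"
    then obtain f1 f2 where f: "f = (f1, f2)" "f1 \<in> Mor C" "f2 \<in> Mor D" by auto
    then show "Dom (binprod_cat C D) f \<in> Obj (binprod_cat C D)"
      "Cod (binprod_cat C D) f \<in> Obj (binprod_cat C D)"
      "Comp (binprod_cat C D) (Ident (binprod_cat C D) (Cod (binprod_cat C D) f)) f = f"
      "Comp (binprod_cat C D) f (Ident (binprod_cat C D) (Dom (binprod_cat C D) f)) = f"
      by (simp_all add: C.Dom_in D.Dom_in C.Cod_in D.Cod_in C.Comp_Ident_left D.Comp_Ident_left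
          C.Comp_Ident_right D.Comp_Ident_right)
    fix g assume "g \<in> Mor (binprod_cat C D)" "Dom (binprod_cat C D) g = Cod (binprod_cat C D) f"
    then obtain g1 g2 where g: "g = (g1, g2)" "g1 \<in> Mor C" "g2 \<in> Mor D"
      "Dom C g1 = Cod C f1" "Dom D g2 = Cod D f2" using f by auto
    then show "Comp (binprod_cat C D) g f
        \<in> Hom (binprod_cat C D) (Dom (binprod_cat C D) f) (Cod (binprod_cat C D) g)"
      using f C.Comp_in[of f1 g1] D.Comp_in[of f2 g2] by simp
    fix h assume "h \<in> Mor (binprod_cat C D)" "Dom (binprod_cat C D) h = Cod (binprod_cat C D) g"
    then obtain h1 h2 where h: "h = (h1, h2)" "h1 \<in> Mor C" "h2 \<in> Mor D"
      "Dom C h1 = Cod C g1" "Dom D h2 = Cod D g2" using g by auto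
    then show "Comp (binprod_cat C D) h (Comp (binprod_cat C D) g f)
        = Comp (binprod_cat C D) (Comp (binprod_cat C D) h g) f"
      using f g C.Comp_assoc[of f1 g1 h1] D.Comp_assoc[of f2 g2 h2] by simp
  next
    fix A assume "A \<in> Obj (binprod_cat C D)"
    then show "Ident (binprod_cat C D) A \<in> Hom (binprod_cat C D) A A"
      by (cases A) (simp add: C.Ident_in D.Ident_in)
  qed
qed

lemma isomorphic_binprod_cat:
  "isomorphic (binprod_cat C D) (A, B) (A', B') \<longleftrightarrow> isomorphic C A A' \<and> isomorphic D B B'"
proof -
  have "inverse_pair (binprod_cat C D) (A, B) (A', B') (f, f') (g, g') \<longleftrightarrow>
      inverse_pair C A A' f g \<and> inverse_pair D B B' f' g'" for f f' g g'
    unfolding inverse_pair_def by auto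
  then show ?thesis by (auto simp: isomorphic_def)
qed

section \<open>Full subcategories compared with the ambient category\<close>

lemma full_subcategory_Hom:
  assumes full: "full_subcategory S C" and A: "A \<in> Obj S" and B: "B \<in> Obj S"
  shows "Hom S A B = Hom C A B"
proof -
  interpret subcategory S C using full by (simp add: full_subcategory_def)
  have "Hom C A B \<subseteq> Mor S" using full A B by (simp add: full_subcategory_def)
  then show ?thesis using Mor_sub Dom_sub Cod_sub by (auto simp: Hom_def)
qed

lemma full_subcategory_Comp:
  assumes "full_subcategory S C" "f \<in> Hom S A B" "g \<in> Hom S B D"
  shows "Comp S g f = Comp C g f"
  using assms subcategory.Comp_sub[of S C f g] by (auto simp: full_subcategory_def Hom_def)

lemma full_subcategory_Ident:
  "\<lbrakk>full_subcategory S C; A \<in> Obj S\<rbrakk> \<Longrightarrow> Ident S A = Ident C A"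
  by (simp add: full_subcategory_def subcategory.Ident_sub)

text \<open>Fullness brings both a morphism and its inverse into \<open>S\<close>. This lets
  isomorphism of pairs in \<open>binprod_cat T F\<close> be tested in \<open>C\<close>.\<close>

lemma full_subcategory_isomorphic:
  assumes S: "full_subcategory S C" and A: "A \<in> Obj S" and B: "B \<in> Obj S"
  shows "isomorphic S A B \<longleftrightarrow> isomorphic C A B"
proof -
  have "inverse_pair S A B f g \<longleftrightarrow> inverse_pair C A B f g" for f g
  proof (cases "f \<in> Hom S A B \<and> g \<in> Hom S B A")
    case True
    then have "Comp S g f = Comp C g f" "Comp S f g = Comp C f g"
      using full_subcategory_Comp[OF S] by blast+
    then show ?thesis
      using True by (simp add: inverse_pair_def full_subcategory_Hom[OF S] full_subcategory_Ident[OF S] A B)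
  next
    case False
    then show ?thesis by (auto simp: inverse_pair_def full_subcategory_Hom[OF S] A B)
  qed
  then show ?thesis by (simp add: isomorphic_def)
qed

text \<open>Middle components of maps of sequences with prescribed ends \<open>a\<close> and
  \<open>b\<close>. For the chosen sequences these are the preimages of \<open>(a, b)\<close> under
  the pair functor.\<close>

definition fillers :: "('o, 'm) cat \<Rightarrow> 'm \<Rightarrow> 'm \<Rightarrow> 'm \<Rightarrow> 'm \<Rightarrow> 'm \<Rightarrow> 'm \<Rightarrow> 'm set" where
  "fillers C m e m' e' a b =
    {g \<in> Hom C (Cod C m) (Cod C m'). Comp C m' a = Comp C g m \<and> Comp C b e = Comp C e' g}"

definition unique_fillers :: "('o, 'm) cat \<Rightarrow> ('o, 'm) cat \<Rightarrow> ('o, 'm) cat \<Rightarrow> bool" where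
  "unique_fillers C T F \<longleftrightarrow> (\<forall>X Y m e m' e' a b.
    torsion_sequence C T F X (m, e) \<and> torsion_sequence C T F Y (m', e') \<and>
    a \<in> Hom C (Dom C m) (Dom C m') \<and> b \<in> Hom C (Cod C e) (Cod C e') \<longrightarrow>
    (\<exists>!g. g \<in> fillers C m e m' e' a b))"

text \<open>Essential surjectivity of the pair functor, freed from the choice. Isomorphism is taken
  in \<open>C\<close>, which agrees with that in \<open>T\<close> and \<open>F\<close> when these
  are full.\<close>

definition realises_pairs :: "('o, 'm) cat \<Rightarrow> ('o, 'm) cat \<Rightarrow> ('o, 'm) cat \<Rightarrow> bool" where
  "realises_pairs C T F \<longleftrightarrow> (\<forall>A \<in> Obj T. \<forall>B \<in> Obj F. \<exists>X m e. torsion_sequence C T F X (m, e) \<and>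
    isomorphic C (Dom C m) A \<and> isomorphic C (Cod C e) B)"

section \<open>Universal properties of torsion and torsion-free parts\<close>

locale pretorsion_category = category C for C :: "('o, 'm) cat" +
  fixes T F :: "('o, 'm) cat"
  assumes pretorsion: "pretorsion_theory C T F"
begin

lemma full_T: "full_subcategory T C" and full_F: "full_subcategory F C"
  using pretorsion by (auto simp: pretorsion_theory_def)

lemma null_Hom: "\<lbrakk>A \<in> Obj T; B \<in> Obj F; f \<in> Hom C A B\<rbrakk> \<Longrightarrow> null_mor C (Obj T \<inter> Obj F) f"
  using pretorsion unfolding pretorsion_theory_def by blast

lemma torsion_sequenceD:
  assumes "torsion_sequence C T F X (m, e)"
  shows "m \<in> Hom C (Dom C m) X" "e \<in> Hom C X (Cod C e)" "Dom C m \<in> Obj T" "Cod C e \<in> Obj F" "X \<in> Obj C"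
proof -
  have s: "is_kernel C (Obj T \<inter> Obj F) e m" "Cod C m = X"
    and TF: "Dom C m \<in> Obj T" "Cod C e \<in> Obj F"
    using assms unfolding torsion_sequence_def short_exact_def by blast+
  from s(1) have "e \<in> Mor C" "m \<in> Mor C" "Cod C m = Dom C e"
    unfolding is_kernel_def by blast+
  then show m: "m \<in> Hom C (Dom C m) X" and "e \<in> Hom C X (Cod C e)"
    using s(2) by (auto simp: Hom_def)
  show "Dom C m \<in> Obj T" "Cod C e \<in> Obj F" by (fact TF)+
  show "X \<in> Obj C" using Hom_Obj[OF m] by blast
qed

text \<open>Since \<open>e \<cdot> u\<close> leads from \<open>T\<close> to \<open>F\<close>, it is
  null by T1, and the kernel property applies to every \<open>u\<close> with torsion source. Thus
  \<open>m\<close> is a coreflection of \<open>X\<close> into \<open>T\<close>.\<close>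

lemma torsion_part_universal:
  assumes s: "torsion_sequence C T F X (m, e)" and U: "U \<in> Obj T" and u: "u \<in> Hom C U X"
  shows "\<exists>!u'. u' \<in> Hom C U (Dom C m) \<and> m \<cdot> u' = u"
proof -
  have "null_mor C (Obj T \<inter> Obj F) (e \<cdot> u)"
    using null_Hom[OF U torsion_sequenceD(4)[OF s] comp_Hom[OF u torsion_sequenceD(2)[OF s]]] .
  moreover have "u \<in> Mor C" "Cod C u = Dom C e" "Dom C u = U"
    using u torsion_sequenceD(2)[OF s] by (auto simp: Hom_def)
  moreover have "is_kernel C (Obj T \<inter> Obj F) e m"
    using s by (simp add: torsion_sequence_def short_exact_def)
  ultimately have "\<exists>!u'. u' \<in> Hom C U (Dom C m) \<and> u = m \<cdot> u'"
    unfolding is_kernel_def by blast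
  then show ?thesis unfolding eq_commute[of u] .
qed

lemma torsionfree_part_universal:
  assumes s: "torsion_sequence C T F X (m, e)" and V: "V \<in> Obj F" and v: "v \<in> Hom C X V"
  shows "\<exists>!v'. v' \<in> Hom C (Cod C e) V \<and> v' \<cdot> e = v"
proof -
  have "null_mor C (Obj T \<inter> Obj F) (v \<cdot> m)"
    using null_Hom[OF torsion_sequenceD(3)[OF s] V comp_Hom[OF torsion_sequenceD(1)[OF s] v]] .
  moreover have "v \<in> Mor C" "Dom C v = Cod C m" "Cod C v = V"
    using v torsion_sequenceD(1)[OF s] by (auto simp: Hom_def)
  moreover have "is_cokernel C (Obj T \<inter> Obj F) m e"
    using s by (simp add: torsion_sequence_def short_exact_def)
  ultimately have "\<exists>!v'. v' \<in> Hom C (Cod C e) V \<and> v = v' \<cdot> e"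
    unfolding is_cokernel_def by blast
  then show ?thesis unfolding eq_commute[of v] .
qed

text \<open>The source \<open>U\<close> is a torsion object so that T1 supplies the nullness which
  the kernel property asks for.\<close>

lemma torsion_part_cancel:
  assumes s: "torsion_sequence C T F X (m, e)" and U: "U \<in> Obj T"
    and u: "u \<in> Hom C U (Dom C m)" "u' \<in> Hom C U (Dom C m)"
  shows "m \<cdot> u = m \<cdot> u' \<longleftrightarrow> u = u'"
  using torsion_part_universal[OF s U comp_Hom[OF u(1) torsion_sequenceD(1)[OF s]]] u by metis

lemma torsionfree_part_cancel:
  assumes s: "torsion_sequence C T F X (m, e)" and V: "V \<in> Obj F"
    and v: "v \<in> Hom C (Cod C e) V" "v' \<in> Hom C (Cod C e) V"
  shows "v \<cdot> e = v' \<cdot> e \<longleftrightarrow> v = v'"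
  using torsionfree_part_universal[OF s V comp_Hom[OF torsion_sequenceD(2)[OF s] v(1)]] v by metis

text \<open>Each torsion part factors through the other by universality, and cancelling
  \<open>m\<close> and \<open>m'\<close> shows that the two factorizations are mutually inverse.
  Their compatibility with \<open>m\<close> and \<open>m'\<close> is recorded for transporting
  fillers.\<close>

lemma torsion_part_unique:
  assumes s: "torsion_sequence C T F X (m, e)" and s': "torsion_sequence C T F X (m', e')"
  obtains p q where "inverse_pair C (Dom C m) (Dom C m') p q" "m' \<cdot> p = m" "m \<cdot> q = m'"
proof -
  note D = torsion_sequenceD[OF s] and D' = torsion_sequenceD[OF s']
  obtain p where p: "p \<in> Hom C (Dom C m) (Dom C m')" "m' \<cdot> p = m"
    using torsion_part_universal[OF s' D(3,1)] by blast
  obtain q where q: "q \<in> Hom C (Dom C m') (Dom C m)" "m \<cdot> q = m'"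
    using torsion_part_universal[OF s D'(3,1)] by blast
  have O: "Dom C m \<in> Obj C" "Dom C m' \<in> Obj C" using Hom_Obj p by auto
  have "m \<cdot> q \<cdot> p = m \<cdot> Ident C (Dom C m)"
    using comp_assoc[OF p(1) q(1) D(1)] p(2) q(2) id_right[OF D(1)] by simp
  then have "q \<cdot> p = Ident C (Dom C m)"
    using torsion_part_cancel[OF s D(3) comp_Hom[OF p(1) q(1)] Ident_in[OF O(1)]] by blast
  moreover have "m' \<cdot> p \<cdot> q = m' \<cdot> Ident C (Dom C m')"
    using comp_assoc[OF q(1) p(1) D'(1)] p(2) q(2) id_right[OF D'(1)] by simp
  then have "p \<cdot> q = Ident C (Dom C m')"
    using torsion_part_cancel[OF s' D'(3) comp_Hom[OF q(1) p(1)] Ident_in[OF O(2)]] by blast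
  ultimately show ?thesis using that p q by (simp add: inverse_pair_def)
qed

lemma torsionfree_part_unique:
  assumes s: "torsion_sequence C T F X (m, e)" and s': "torsion_sequence C T F X (m', e')"
  obtains p q where "inverse_pair C (Cod C e) (Cod C e') p q" "p \<cdot> e = e'" "q \<cdot> e' = e"
proof -
  note D = torsion_sequenceD[OF s] and D' = torsion_sequenceD[OF s']
  obtain p where p: "p \<in> Hom C (Cod C e) (Cod C e')" "p \<cdot> e = e'"
    using torsionfree_part_universal[OF s D'(4,2)] by blast
  obtain q where q: "q \<in> Hom C (Cod C e') (Cod C e)" "q \<cdot> e' = e"
    using torsionfree_part_universal[OF s' D(4,2)] by blast
  have O: "Cod C e \<in> Obj C" "Cod C e' \<in> Obj C" using Hom_Obj p by auto
  have "(q \<cdot> p) \<cdot> e = Ident C (Cod C e) \<cdot> e"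
    using comp_assoc[OF D(2) p(1) q(1)] p(2) q(2) id_left[OF D(2)] by simp
  then have "q \<cdot> p = Ident C (Cod C e)"
    using torsionfree_part_cancel[OF s D(4) comp_Hom[OF p(1) q(1)] Ident_in[OF O(1)]] by blast
  moreover have "(p \<cdot> q) \<cdot> e' = Ident C (Cod C e') \<cdot> e'"
    using comp_assoc[OF D'(2) q(1) p(1)] p(2) q(2) id_left[OF D'(2)] by simp
  then have "p \<cdot> q = Ident C (Cod C e')"
    using torsionfree_part_cancel[OF s' D'(4) comp_Hom[OF q(1) p(1)] Ident_in[OF O(2)]] by blast
  ultimately show ?thesis using that p q by (simp add: inverse_pair_def)
qed

section \<open>The functors attached to the chosen sequences\<close>

abbreviation "\<mu> \<equiv> torsion_mono C T F"
abbreviation "\<pi> \<equiv> torsionfree_epi C T F"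
abbreviation "t \<equiv> torsion_functor C T F"
abbreviation "f \<equiv> torsionfree_functor C T F"

lemma chosen_torsion_sequence:
  assumes "X \<in> Obj C" shows "torsion_sequence C T F X (\<mu> X, \<pi> X)"
proof -
  have "\<exists>s. torsion_sequence C T F X s"
    using assms pretorsion by (simp add: pretorsion_theory_def)
  then show ?thesis
    unfolding torsion_mono_def torsionfree_epi_def chosen_sequence_def prod.collapse by (rule someI_ex)
qed

lemma OMap_t: "OMap t X = Dom C (\<mu> X)" and OMap_f: "OMap f X = Cod C (\<pi> X)"
  by (simp_all add: torsion_functor_def torsionfree_functor_def Let_def)

lemma \<mu>_Hom: "X \<in> Obj C \<Longrightarrow> \<mu> X \<in> Hom C (OMap t X) X"
  and t_Obj: "X \<in> Obj C \<Longrightarrow> OMap t X \<in> Obj T"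
  and \<pi>_Hom: "X \<in> Obj C \<Longrightarrow> \<pi> X \<in> Hom C X (OMap f X)"
  and f_Obj: "X \<in> Obj C \<Longrightarrow> OMap f X \<in> Obj F"
  using torsion_sequenceD[OF chosen_torsion_sequence] by (simp_all add: OMap_t OMap_f)

lemma MMap_t:
  assumes g: "g \<in> Hom C X Y"
  shows "MMap t g \<in> Hom C (OMap t X) (OMap t Y) \<and> \<mu> Y \<cdot> MMap t g = g \<cdot> \<mu> X"
proof -
  have X: "X \<in> Obj C" and Y: "Y \<in> Obj C" using Hom_Obj[OF g] by auto
  have "\<exists>!h. h \<in> Hom C (OMap t X) (OMap t Y) \<and> \<mu> Y \<cdot> h = g \<cdot> \<mu> X"
    using torsion_part_universal[OF chosen_torsion_sequence[OF Y] t_Obj[OF X] comp_Hom[OF \<mu>_Hom[OF X] g]]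
    by (simp add: OMap_t)
  from theI'[OF this] show ?thesis
    using g by (simp add: torsion_functor_def Let_def Hom_def)
qed

lemma MMap_f:
  assumes g: "g \<in> Hom C X Y"
  shows "MMap f g \<in> Hom C (OMap f X) (OMap f Y) \<and> MMap f g \<cdot> \<pi> X = \<pi> Y \<cdot> g"
proof -
  have X: "X \<in> Obj C" and Y: "Y \<in> Obj C" using Hom_Obj[OF g] by auto
  have "\<exists>!h. h \<in> Hom C (OMap f X) (OMap f Y) \<and> h \<cdot> \<pi> X = \<pi> Y \<cdot> g"
    using torsionfree_part_universal[OF chosen_torsion_sequence[OF X] f_Obj[OF Y] comp_Hom[OF g \<pi>_Hom[OF Y]]]
    by (simp add: OMap_f)
  from theI'[OF this] show ?thesis
    using g by (simp add: torsionfree_functor_def Let_def Hom_def)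
qed

text \<open>\<open>\<mu> Y\<close> cancels against morphisms from the torsion object
  \<open>OMap t X\<close>, so the defining square determines the value. Both functoriality and the
  description of preimages reduce to checking this square.\<close>

lemma MMap_t_eq_iff:
  assumes g: "g \<in> Hom C X Y" and h: "h \<in> Hom C (OMap t X) (OMap t Y)"
  shows "MMap t g = h \<longleftrightarrow> \<mu> Y \<cdot> h = g \<cdot> \<mu> X"
proof -
  have X: "X \<in> Obj C" and Y: "Y \<in> Obj C" using Hom_Obj[OF g] by auto
  show ?thesis
    using torsion_part_cancel[OF chosen_torsion_sequence[OF Y] t_Obj[OF X], folded OMap_t, OF _ h]
      MMap_t[OF g] by auto
qed

lemma MMap_f_eq_iff:
  assumes g: "g \<in> Hom C X Y" and h: "h \<in> Hom C (OMap f X) (OMap f Y)"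
  shows "MMap f g = h \<longleftrightarrow> h \<cdot> \<pi> X = \<pi> Y \<cdot> g"
proof -
  have X: "X \<in> Obj C" and Y: "Y \<in> Obj C" using Hom_Obj[OF g] by auto
  show ?thesis
    using torsionfree_part_cancel[OF chosen_torsion_sequence[OF X] f_Obj[OF Y], folded OMap_f, OF _ h]
      MMap_f[OF g] by auto
qed

lemma is_functor_t: "is_functor C T t"
  unfolding is_functor_def
proof (intro conjI ballI impI)
  fix X assume X: "X \<in> Obj C"
  show tX: "OMap t X \<in> Obj T" using t_Obj[OF X] .
  have "MMap t (Ident C X) = Ident C (OMap t X)"
    using MMap_t_eq_iff[OF Ident_in[OF X] Ident_in] \<mu>_Hom[OF X] Hom_Obj[OF \<mu>_Hom[OF X]]
    by (simp add: id_left id_right)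
  then show "MMap t (Ident C X) = Ident T (OMap t X)"
    using full_subcategory_Ident[OF full_T tX] by simp
next
  fix g assume g: "g \<in> Mor C"
  show "MMap t g \<in> Hom T (OMap t (Dom C g)) (OMap t (Cod C g))"
    using MMap_t[OF Mor_Hom[OF g]] full_subcategory_Hom[OF full_T] t_Obj Dom_in[OF g] Cod_in[OF g] by simp
next
  fix g h assume "g \<in> Mor C" "h \<in> Mor C" "Dom C h = Cod C g"
  then obtain X Y Z where g: "g \<in> Hom C X Y" and h: "h \<in> Hom C Y Z" by (auto simp: Hom_def)
  have O: "X \<in> Obj C" "Y \<in> Obj C" "Z \<in> Obj C" using Hom_Obj g h by blast+
  note tg = MMap_t[OF g] and th = MMap_t[OF h]
  note tgH = tg[THEN conjunct1] and thH = th[THEN conjunct1]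
  have "\<mu> Z \<cdot> MMap t h \<cdot> MMap t g = (h \<cdot> \<mu> Y) \<cdot> MMap t g"
    using th comp_assoc[OF tgH thH \<mu>_Hom[OF O(3)]] by simp
  also have "\<dots> = (h \<cdot> g) \<cdot> \<mu> X"
    using tg comp_assoc[OF tgH \<mu>_Hom[OF O(2)] h] comp_assoc[OF \<mu>_Hom[OF O(1)] g h] by simp
  finally have "MMap t (h \<cdot> g) = MMap t h \<cdot> MMap t g"
    using MMap_t_eq_iff[OF comp_Hom[OF g h] comp_Hom[OF tgH thH]] by simp
  \<comment> \<open>The target of \<open>t\<close> is \<open>T\<close>, whose composition agrees
    with that of \<open>C\<close> only on morphisms of \<open>T\<close>; fullness puts both factors
    there.\<close>
  also have "\<dots> = Comp T (MMap t h) (MMap t g)"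
    using full_subcategory_Comp[OF full_T, of "MMap t g" "OMap t X" "OMap t Y" "MMap t h" "OMap t Z"]
      full_subcategory_Hom[OF full_T] tgH thH t_Obj O by simp
  finally show "MMap t (h \<cdot> g) = Comp T (MMap t h) (MMap t g)" .
qed

lemma is_functor_f: "is_functor C F f"
  unfolding is_functor_def
proof (intro conjI ballI impI)
  fix X assume X: "X \<in> Obj C"
  show fX: "OMap f X \<in> Obj F" using f_Obj[OF X] .
  have "MMap f (Ident C X) = Ident C (OMap f X)"
    using MMap_f_eq_iff[OF Ident_in[OF X] Ident_in] \<pi>_Hom[OF X] Hom_Obj[OF \<pi>_Hom[OF X]]
    by (simp add: id_left id_right)
  then show "MMap f (Ident C X) = Ident F (OMap f X)"
    using full_subcategory_Ident[OF full_F fX] by simp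
next
  fix g assume g: "g \<in> Mor C"
  show "MMap f g \<in> Hom F (OMap f (Dom C g)) (OMap f (Cod C g))"
    using MMap_f[OF Mor_Hom[OF g]] full_subcategory_Hom[OF full_F] f_Obj Dom_in[OF g] Cod_in[OF g] by simp
next
  fix g h assume "g \<in> Mor C" "h \<in> Mor C" "Dom C h = Cod C g"
  then obtain X Y Z where g: "g \<in> Hom C X Y" and h: "h \<in> Hom C Y Z" by (auto simp: Hom_def)
  have O: "X \<in> Obj C" "Y \<in> Obj C" "Z \<in> Obj C" using Hom_Obj g h by blast+
  note fg = MMap_f[OF g] and fh = MMap_f[OF h]
  note fgH = fg[THEN conjunct1] and fhH = fh[THEN conjunct1]
  have "(MMap f h \<cdot> MMap f g) \<cdot> \<pi> X = MMap f h \<cdot> \<pi> Y \<cdot> g"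
    using fg comp_assoc[OF \<pi>_Hom[OF O(1)] fgH fhH] by simp
  also have "\<dots> = \<pi> Z \<cdot> h \<cdot> g"
    using fh comp_assoc[OF g \<pi>_Hom[OF O(2)] fhH] comp_assoc[OF g h \<pi>_Hom[OF O(3)]] by simp
  finally have "MMap f (h \<cdot> g) = MMap f h \<cdot> MMap f g"
    using MMap_f_eq_iff[OF comp_Hom[OF g h] comp_Hom[OF fgH fhH]] by simp
  also have "\<dots> = Comp F (MMap f h) (MMap f g)"
    using full_subcategory_Comp[OF full_F, of "MMap f g" "OMap f X" "OMap f Y" "MMap f h" "OMap f Z"]
      full_subcategory_Hom[OF full_F] fgH fhH f_Obj O by simp
  finally show "MMap f (h \<cdot> g) = Comp F (MMap f h) (MMap f g)" .
qed

lemma is_functor_pair: "is_functor C (binprod_cat T F) (pair_functor t f)"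
  using is_functor_t is_functor_f unfolding is_functor_def pair_functor_def by simp

text \<open>Conjugating \<open>a\<close> and \<open>b\<close> with the canonical isomorphisms
  between two sequences of the same object leaves the fillers unchanged: each new filler equation is
  the old one composed with an isomorphism, \<open>q\<close> on the right for the torsion square and
  \<open>k'\<close> on the left for the torsion-free square.\<close>

lemma fillers_change_sequences:
  assumes s: "torsion_sequence C T F X (m, e)" and s': "torsion_sequence C T F Y (m', e')"
    and r: "torsion_sequence C T F X (n, d)" and r': "torsion_sequence C T F Y (n', d')"
    and a: "a \<in> Hom C (Dom C m) (Dom C m')" and b: "b \<in> Hom C (Cod C e) (Cod C e')"
  obtains a' b' where "a' \<in> Hom C (Dom C n) (Dom C n')" "b' \<in> Hom C (Cod C d) (Cod C d')"
    "fillers C n d n' d' a' b' = fillers C m e m' e' a b"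
proof -
  obtain p q where pq: "inverse_pair C (Dom C m) (Dom C n) p q" and p: "n \<cdot> p = m" and q: "m \<cdot> q = n"
    using torsion_part_unique[OF s r] .
  obtain p' q' where pq': "inverse_pair C (Dom C m') (Dom C n') p' q'" and p': "n' \<cdot> p' = m'"
    using torsion_part_unique[OF s' r'] .
  obtain k l where kl: "inverse_pair C (Cod C e) (Cod C d) k l" and k: "k \<cdot> e = d" and l: "l \<cdot> d = e"
    using torsionfree_part_unique[OF s r] .
  obtain k' l' where kl': "inverse_pair C (Cod C e') (Cod C d') k' l'" and k': "k' \<cdot> e' = d'"
    using torsionfree_part_unique[OF s' r'] .
  note H = pq[unfolded inverse_pair_def] pq'[unfolded inverse_pair_def]
    kl[unfolded inverse_pair_def] kl'[unfolded inverse_pair_def]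
  note D = torsion_sequenceD[OF s] and D' = torsion_sequenceD[OF s']
    and E = torsion_sequenceD[OF r] and E' = torsion_sequenceD[OF r']
  have qH: "q \<in> Hom C (Dom C n) (Dom C m)" and p'H: "p' \<in> Hom C (Dom C m') (Dom C n')"
    and lH: "l \<in> Hom C (Cod C d) (Cod C e)" and k'H: "k' \<in> Hom C (Cod C e') (Cod C d')"
    using H by auto
  have qp: "inverse_pair C (Dom C n) (Dom C m) q p"
    using pq by (simp add: inverse_pair_def)
  have aq: "a \<cdot> q \<in> Hom C (Dom C n) (Dom C m')" and bl: "b \<cdot> l \<in> Hom C (Cod C d) (Cod C e')"
    using comp_Hom[OF qH a] comp_Hom[OF lH b] .
  \<comment> \<open>Substituting \<open>n' \<cdot> p' = m'\<close> and
    \<open>n = m \<cdot> q\<close> lets both sides end in \<open>q\<close>, which cancels.\<close>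
  have "n' \<cdot> p' \<cdot> a \<cdot> q = g \<cdot> n \<longleftrightarrow> m' \<cdot> a = g \<cdot> m" if g: "g \<in> Hom C X Y" for g
  proof -
    have "n' \<cdot> p' \<cdot> a \<cdot> q = (m' \<cdot> a) \<cdot> q"
      using comp_assoc[OF aq p'H E'(1)] comp_assoc[OF qH a D'(1)] p' by simp
    moreover have "g \<cdot> n = (g \<cdot> m) \<cdot> q"
      using comp_assoc[OF qH D(1) g] q by simp
    ultimately show ?thesis
      using inverse_pair_cancel_right[OF qp comp_Hom[OF a D'(1)] comp_Hom[OF D(1) g]] by simp
  qed
  moreover have "(k' \<cdot> b \<cdot> l) \<cdot> d = d' \<cdot> g \<longleftrightarrow> b \<cdot> e = e' \<cdot> g" if g: "g \<in> Hom C X Y" for g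
  proof -
    have "(k' \<cdot> b \<cdot> l) \<cdot> d = k' \<cdot> b \<cdot> e"
      using comp_assoc[OF E(2) bl k'H] comp_assoc[OF E(2) lH b] l by simp
    moreover have "d' \<cdot> g = k' \<cdot> e' \<cdot> g"
      using comp_assoc[OF g D'(2) k'H] k' by simp
    ultimately show ?thesis
      using inverse_pair_cancel_left[OF kl' comp_Hom[OF D(2) b] comp_Hom[OF g D'(2)]] by simp
  qed
  moreover have "Cod C m = X" "Cod C m' = Y" "Cod C n = X" "Cod C n' = Y"
    using D(1) D'(1) E(1) E'(1) by (auto simp: Hom_def)
  ultimately have "fillers C n d n' d' (p' \<cdot> a \<cdot> q) (k' \<cdot> b \<cdot> l) = fillers C m e m' e' a b"
    unfolding fillers_def by auto
  then show ?thesis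
    using that comp_Hom[OF aq p'H] comp_Hom[OF bl k'H] by blast
qed

text \<open>The defining squares of \<open>MMap t g = a\<close> and \<open>MMap f g = b\<close> are
  the two filler equations.\<close>

lemma pair_functor_preimage:
  assumes X: "X \<in> Obj C" and Y: "Y \<in> Obj C"
    and a: "a \<in> Hom C (OMap t X) (OMap t Y)" and b: "b \<in> Hom C (OMap f X) (OMap f Y)"
  shows "g \<in> Hom C X Y \<and> MMap (pair_functor t f) g = (a, b) \<longleftrightarrow>
    g \<in> fillers C (\<mu> X) (\<pi> X) (\<mu> Y) (\<pi> Y) a b"
proof -
  have "Cod C (\<mu> X) = X" "Cod C (\<mu> Y) = Y"
    using \<mu>_Hom[OF X] \<mu>_Hom[OF Y] by (auto simp: Hom_def)
  then show ?thesis
    using MMap_t_eq_iff[OF _ a] MMap_f_eq_iff[OF _ b] by (auto simp: fillers_def pair_functor_def)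
qed

text \<open>In one direction arbitrary sequences are replaced by the chosen ones without changing
  the fillers; in the other the chosen sequences are an instance.\<close>

lemma fully_faithful_pair_iff:
  "fully_faithful C (binprod_cat T F) (pair_functor t f) \<longleftrightarrow> unique_fillers C T F"
proof
  assume ff: "fully_faithful C (binprod_cat T F) (pair_functor t f)"
  have chosen: "\<exists>!g. g \<in> fillers C (\<mu> X) (\<pi> X) (\<mu> Y) (\<pi> Y) a b"
    if X: "X \<in> Obj C" and Y: "Y \<in> Obj C"
      and a: "a \<in> Hom C (OMap t X) (OMap t Y)" and b: "b \<in> Hom C (OMap f X) (OMap f Y)" for X Y a b
  proof -
    have "(a, b) \<in> Hom (binprod_cat T F) (OMap (pair_functor t f) X) (OMap (pair_functor t f) Y)"
      using a b full_subcategory_Hom[OF full_T t_Obj[OF X] t_Obj[OF Y]]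
        full_subcategory_Hom[OF full_F f_Obj[OF X] f_Obj[OF Y]] by (simp add: pair_functor_def)
    then have "\<exists>!g. g \<in> Hom C X Y \<and> MMap (pair_functor t f) g = (a, b)"
      using ff X Y unfolding fully_faithful_def by blast
    then show ?thesis unfolding pair_functor_preimage[OF X Y a b] .
  qed
  show "unique_fillers C T F"
    unfolding unique_fillers_def
  proof (intro allI impI, elim conjE)
    fix X Y m e m' e' a b
    assume s: "torsion_sequence C T F X (m, e)" "torsion_sequence C T F Y (m', e')"
      and ab: "a \<in> Hom C (Dom C m) (Dom C m')" "b \<in> Hom C (Cod C e) (Cod C e')"
    have X: "X \<in> Obj C" and Y: "Y \<in> Obj C" using s torsion_sequenceD by blast+
    obtain a' b' where "a' \<in> Hom C (OMap t X) (OMap t Y)" "b' \<in> Hom C (OMap f X) (OMap f Y)"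
      and eq: "fillers C (\<mu> X) (\<pi> X) (\<mu> Y) (\<pi> Y) a' b' = fillers C m e m' e' a b"
      using fillers_change_sequences[OF s chosen_torsion_sequence[OF X] chosen_torsion_sequence[OF Y] ab]
      unfolding OMap_t OMap_f .
    from chosen[OF X Y this(1,2)] show "\<exists>!g. g \<in> fillers C m e m' e' a b"
      unfolding eq .
  qed
next
  assume uf: "unique_fillers C T F"
  show "fully_faithful C (binprod_cat T F) (pair_functor t f)"
    unfolding fully_faithful_def
  proof (intro ballI)
    fix X Y h
    assume X: "X \<in> Obj C" and Y: "Y \<in> Obj C"
      and h: "h \<in> Hom (binprod_cat T F) (OMap (pair_functor t f) X) (OMap (pair_functor t f) Y)"
    obtain a b where ab: "h = (a, b)" by (cases h)
    have a: "a \<in> Hom C (OMap t X) (OMap t Y)" and b: "b \<in> Hom C (OMap f X) (OMap f Y)"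
      using h ab full_subcategory_Hom[OF full_T t_Obj[OF X] t_Obj[OF Y]]
        full_subcategory_Hom[OF full_F f_Obj[OF X] f_Obj[OF Y]] by (simp_all add: pair_functor_def)
    show "\<exists>!g. g \<in> Hom C X Y \<and> MMap (pair_functor t f) g = h"
      unfolding ab pair_functor_preimage[OF X Y a b]
      using uf chosen_torsion_sequence[OF X] chosen_torsion_sequence[OF Y] a b
      unfolding unique_fillers_def OMap_t OMap_f by blast
  qed
qed

lemma essentially_surjective_pair_iff:
  "essentially_surjective C (binprod_cat T F) (pair_functor t f) \<longleftrightarrow> realises_pairs C T F"
proof -
  have iso: "isomorphic (binprod_cat T F) (OMap (pair_functor t f) X) (A, B) \<longleftrightarrow>
      isomorphic C (OMap t X) A \<and> isomorphic C (OMap f X) B"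
    if "X \<in> Obj C" "A \<in> Obj T" "B \<in> Obj F" for X A B
    using full_subcategory_isomorphic[OF full_T t_Obj] full_subcategory_isomorphic[OF full_F f_Obj] that
    by (simp add: pair_functor_def isomorphic_binprod_cat)
  have "(\<exists>X \<in> Obj C. isomorphic C (OMap t X) A \<and> isomorphic C (OMap f X) B) \<longleftrightarrow>
      (\<exists>X m e. torsion_sequence C T F X (m, e) \<and> isomorphic C (Dom C m) A \<and> isomorphic C (Cod C e) B)"
    (is "?L \<longleftrightarrow> ?R") for A B
  proof
    assume ?L
    then obtain X where X: "X \<in> Obj C" "isomorphic C (OMap t X) A" "isomorphic C (OMap f X) B" by blast
    show ?R
      using chosen_torsion_sequence[OF X(1)] X(2,3) unfolding OMap_t OMap_f by blast
  next
    assume ?R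
    then obtain X m e where s: "torsion_sequence C T F X (m, e)"
      and A: "isomorphic C (Dom C m) A" and B: "isomorphic C (Cod C e) B" by blast
    have X: "X \<in> Obj C" using torsion_sequenceD(5)[OF s] .
    \<comment> \<open>Both parts of \<open>X\<close> are independent of the sequence up to
      isomorphism, so the chosen ones also realise the pair.\<close>
    have "isomorphic C (OMap t X) (Dom C m)" "isomorphic C (OMap f X) (Cod C e)"
      unfolding isomorphic_def OMap_t OMap_f
      by (rule torsion_part_unique[OF chosen_torsion_sequence[OF X] s], blast)
        (rule torsionfree_part_unique[OF chosen_torsion_sequence[OF X] s], blast)
    then show ?L using X A B isomorphic_trans by blast
  qed
  then show ?thesis
    by (simp add: essentially_surjective_def realises_pairs_def iso)
qed

lemma thin_pretorsion_theory_iff: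
  "thin_pretorsion_theory C T F \<longleftrightarrow> unique_fillers C T F \<and> realises_pairs C T F"
proof -
  have "category T" "category F"
    using full_T full_F by (auto simp: full_subcategory_def subcategory_def)
  then have "category (binprod_cat T F)" by (rule category_binprod_cat)
  from is_equivalence_iff[OF category_axioms this is_functor_pair] show ?thesis
    using pretorsion fully_faithful_pair_iff essentially_surjective_pair_iff
    by (simp add: thin_pretorsion_theory_def)
qed

end

section \<open>Thinness in products\<close>

text \<open>Both squares are equations between restricted functions, hence hold exactly if they hold
  at every index. This makes \<open>ex1_PiE_iff\<close> applicable to fillers.\<close>

lemma fillers_prod_cat:
  "fillers (prod_cat I C) m e m' e' a b = (\<Pi>\<^sub>E i\<in>I. fillers (C i) (m i) (e i) (m' i) (e' i) (a i) (b i))"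
  unfolding fillers_def Hom_prod_cat prod_cat_simps set_eq_iff mem_Collect_eq PiE_iff eq_restrict_iff
  by auto

lemma torsion_sequence_prod_cat_update:
  assumes "torsion_sequence (prod_cat I C) (prod_cat I T) (prod_cat I F) X (m, e)" and "i \<in> I"
    and "torsion_sequence (C i) (T i) (F i) X' (m', e')"
  shows "torsion_sequence (prod_cat I C) (prod_cat I T) (prod_cat I F)
    (X(i := X')) (m(i := m'), e(i := e'))"
  using assms by (auto simp: torsion_sequence_prod_cat extensional_def)

lemma unique_fillers_prod_catI:
  assumes uf: "\<And>i. i \<in> I \<Longrightarrow> unique_fillers (C i) (T i) (F i)"
  shows "unique_fillers (prod_cat I C) (prod_cat I T) (prod_cat I F)"
  unfolding unique_fillers_def
proof (intro allI impI, elim conjE)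
  fix X Y m e m' e' a b
  assume s: "torsion_sequence (prod_cat I C) (prod_cat I T) (prod_cat I F) X (m, e)"
    "torsion_sequence (prod_cat I C) (prod_cat I T) (prod_cat I F) Y (m', e')"
    and a: "a \<in> Hom (prod_cat I C) (Dom (prod_cat I C) m) (Dom (prod_cat I C) m')"
    and b: "b \<in> Hom (prod_cat I C) (Cod (prod_cat I C) e) (Cod (prod_cat I C) e')"
  have "\<exists>!g. g \<in> fillers (C i) (m i) (e i) (m' i) (e' i) (a i) (b i)" if i: "i \<in> I" for i
  proof -
    have "torsion_sequence (C i) (T i) (F i) (X i) (m i, e i)"
      "torsion_sequence (C i) (T i) (F i) (Y i) (m' i, e' i)"
      using s i unfolding torsion_sequence_prod_cat by blast+
    moreover have "a i \<in> Hom (C i) (Dom (C i) (m i)) (Dom (C i) (m' i))"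
      "b i \<in> Hom (C i) (Cod (C i) (e i)) (Cod (C i) (e' i))"
      using a b i by (auto simp: Hom_prod_cat PiE_iff)
    ultimately show ?thesis
      using uf[OF i] unfolding unique_fillers_def by blast
  qed
  then show "\<exists>!g. g \<in> fillers (prod_cat I C) m e m' e' a b"
    unfolding fillers_prod_cat ex1_PiE_iff by blast
qed

lemma unique_fillers_prod_catD:
  assumes cat: "\<And>i. i \<in> I \<Longrightarrow> category (C i)"
    and uf: "unique_fillers (prod_cat I C) (prod_cat I T) (prod_cat I F)"
    and base: "torsion_sequence (prod_cat I C) (prod_cat I T) (prod_cat I F) Z (n, d)" and i: "i \<in> I"
  shows "unique_fillers (C i) (T i) (F i)"
  unfolding unique_fillers_def
proof (intro allI impI, elim conjE)
  fix X Y m e m' e' a b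
  assume s: "torsion_sequence (C i) (T i) (F i) X (m, e)"
    and s': "torsion_sequence (C i) (T i) (F i) Y (m', e')"
    and a: "a \<in> Hom (C i) (Dom (C i) m) (Dom (C i) m')"
    and b: "b \<in> Hom (C i) (Cod (C i) e) (Cod (C i) e')"
  \<comment> \<open>Away from \<open>i\<close> both padded sequences are the base sequence, so
    identities on its ends can be prescribed there.\<close>
  let ?a = "(\<lambda>j\<in>I. Ident (C j) (Dom (C j) (n j)))(i := a)"
  let ?b = "(\<lambda>j\<in>I. Ident (C j) (Cod (C j) (d j)))(i := b)"
  have "is_kernel (prod_cat I C) (Obj (prod_cat I T) \<inter> Obj (prod_cat I F)) d n"
    using base by (simp add: torsion_sequence_def short_exact_def)
  then have nd: "n \<in> (\<Pi>\<^sub>E j\<in>I. Mor (C j))" "d \<in> (\<Pi>\<^sub>E j\<in>I. Mor (C j))"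
    unfolding is_kernel_def prod_cat_simps(2) by blast+
  have O: "Dom (C j) (n j) \<in> Obj (C j)" "Cod (C j) (d j) \<in> Obj (C j)" if "j \<in> I" for j
    using category.Dom_in[OF cat[OF that] PiE_mem[OF nd(1) that]]
      category.Cod_in[OF cat[OF that] PiE_mem[OF nd(2) that]] by simp_all
  have "?a \<in> Hom (prod_cat I C) (Dom (prod_cat I C) (n(i := m))) (Dom (prod_cat I C) (n(i := m')))"
    using O a i cat by (auto simp: Hom_prod_cat PiE_iff extensional_def category.Ident_in)
  moreover have "?b \<in> Hom (prod_cat I C) (Cod (prod_cat I C) (d(i := e))) (Cod (prod_cat I C) (d(i := e')))"
    using O b i cat by (auto simp: Hom_prod_cat PiE_iff extensional_def category.Ident_in)
  ultimately have "\<exists>!g. g \<in> fillers (prod_cat I C) (n(i := m)) (d(i := e)) (n(i := m')) (d(i := e')) ?a ?b"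
    using uf torsion_sequence_prod_cat_update[OF base i s] torsion_sequence_prod_cat_update[OF base i s']
    unfolding unique_fillers_def by blast
  from this[unfolded fillers_prod_cat ex1_PiE_iff] i
  have "\<exists>!g. g \<in> fillers (C i) ((n(i := m)) i) ((d(i := e)) i) ((n(i := m')) i) ((d(i := e')) i) (?a i) (?b i)"
    by (rule bspec)
  then show "\<exists>!g. g \<in> fillers (C i) m e m' e' a b" by simp
qed

lemma realises_pairs_prod_catI:
  assumes rp: "\<And>i. i \<in> I \<Longrightarrow> realises_pairs (C i) (T i) (F i)"
  shows "realises_pairs (prod_cat I C) (prod_cat I T) (prod_cat I F)"
  unfolding realises_pairs_def
proof (intro ballI)
  fix A B assume A: "A \<in> Obj (prod_cat I T)" and B: "B \<in> Obj (prod_cat I F)"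
  have "\<forall>i\<in>I. \<exists>r. torsion_sequence (C i) (T i) (F i) (fst r) (snd r) \<and>
      isomorphic (C i) (Dom (C i) (fst (snd r))) (A i) \<and> isomorphic (C i) (Cod (C i) (snd (snd r))) (B i)"
  proof
    fix i assume i: "i \<in> I"
    have "A i \<in> Obj (T i)" "B i \<in> Obj (F i)" using A B i by auto
    then obtain X m e where "torsion_sequence (C i) (T i) (F i) X (m, e)"
      "isomorphic (C i) (Dom (C i) m) (A i)" "isomorphic (C i) (Cod (C i) e) (B i)"
      using rp[OF i] unfolding realises_pairs_def by blast
    then show "\<exists>r. torsion_sequence (C i) (T i) (F i) (fst r) (snd r) \<and>
      isomorphic (C i) (Dom (C i) (fst (snd r))) (A i) \<and> isomorphic (C i) (Cod (C i) (snd (snd r))) (B i)"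
      by (intro exI[of _ "(X, m, e)"]) simp
  qed
  from bchoice[OF this] obtain r where
    r: "\<And>i. i \<in> I \<Longrightarrow> torsion_sequence (C i) (T i) (F i) (fst (r i)) (snd (r i))"
    "\<And>i. i \<in> I \<Longrightarrow> isomorphic (C i) (Dom (C i) (fst (snd (r i)))) (A i)"
    "\<And>i. i \<in> I \<Longrightarrow> isomorphic (C i) (Cod (C i) (snd (snd (r i)))) (B i)"
    by blast
  let ?m = "\<lambda>i\<in>I. fst (snd (r i))" and ?e = "\<lambda>i\<in>I. snd (snd (r i))"
  have "torsion_sequence (prod_cat I C) (prod_cat I T) (prod_cat I F) (\<lambda>i\<in>I. fst (r i)) (?m, ?e)"
    using r(1) by (simp add: torsion_sequence_prod_cat)
  moreover have "isomorphic (prod_cat I C) (Dom (prod_cat I C) ?m) A"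
    "isomorphic (prod_cat I C) (Cod (prod_cat I C) ?e) B"
    using r(2,3) A B by (simp_all add: isomorphic_prod_cat PiE_iff)
  ultimately show "\<exists>X m e. torsion_sequence (prod_cat I C) (prod_cat I T) (prod_cat I F) X (m, e) \<and>
      isomorphic (prod_cat I C) (Dom (prod_cat I C) m) A \<and> isomorphic (prod_cat I C) (Cod (prod_cat I C) e) B"
    by blast
qed

lemma realises_pairs_prod_catD:
  assumes rp: "realises_pairs (prod_cat I C) (prod_cat I T) (prod_cat I F)"
    and base: "torsion_sequence (prod_cat I C) (prod_cat I T) (prod_cat I F) Z (n, d)" and i: "i \<in> I"
  shows "realises_pairs (C i) (T i) (F i)"
  unfolding realises_pairs_def
proof (intro ballI)
  fix A B assume A: "A \<in> Obj (T i)" and B: "B \<in> Obj (F i)"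
  have nd: "Dom (prod_cat I C) n \<in> (\<Pi>\<^sub>E j\<in>I. Obj (T j))" "Cod (prod_cat I C) d \<in> (\<Pi>\<^sub>E j\<in>I. Obj (F j))"
    using base unfolding torsion_sequence_def prod_cat_simps(1) by blast+
  \<comment> \<open>The ends of the base sequence supply torsion and torsion-free objects at the
    remaining indices.\<close>
  have "(Dom (prod_cat I C) n)(i := A) \<in> Obj (prod_cat I T)"
    "(Cod (prod_cat I C) d)(i := B) \<in> Obj (prod_cat I F)"
    unfolding prod_cat_simps(1) using PiE_update[OF nd(1) i A] PiE_update[OF nd(2) i B] .
  then obtain X m e where s: "torsion_sequence (prod_cat I C) (prod_cat I T) (prod_cat I F) X (m, e)"
    and iso: "isomorphic (prod_cat I C) (Dom (prod_cat I C) m) ((Dom (prod_cat I C) n)(i := A))"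
    "isomorphic (prod_cat I C) (Cod (prod_cat I C) e) ((Cod (prod_cat I C) d)(i := B))"
    using rp unfolding realises_pairs_def by blast
  have "torsion_sequence (C i) (T i) (F i) (X i) (m i, e i)"
    using s i unfolding torsion_sequence_prod_cat by blast
  moreover have "isomorphic (C i) (Dom (C i) (m i)) A" "isomorphic (C i) (Cod (C i) (e i)) B"
    using iso[unfolded isomorphic_prod_cat] i by force+
  ultimately show "\<exists>X m e. torsion_sequence (C i) (T i) (F i) X (m, e) \<and>
      isomorphic (C i) (Dom (C i) m) A \<and> isomorphic (C i) (Cod (C i) e) B"
    by blast
qed

theorem theorem4p3:
  fixes I :: "'i set" and C T F :: "'i \<Rightarrow> ('o, 'm) cat"
  assumes "I \<noteq> {}"
    and "\<And>i. i \<in> I \<Longrightarrow> category (C i)"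
    and "\<And>i. i \<in> I \<Longrightarrow> Obj (C i) \<noteq> {}"
    and "\<And>i. i \<in> I \<Longrightarrow> subcategory (T i) (C i)"
    and "\<And>i. i \<in> I \<Longrightarrow> subcategory (F i) (C i)"
  shows "(pretorsion_theory (prod_cat I C) (prod_cat I T) (prod_cat I F) \<longleftrightarrow>
            (\<forall>i\<in>I. pretorsion_theory (C i) (T i) (F i))) \<and>
         ((\<forall>i\<in>I. pretorsion_theory (C i) (T i) (F i)) \<longrightarrow>
            ((\<forall>i\<in>I. thin_pretorsion_theory (C i) (T i) (F i)) \<longleftrightarrow>
             thin_pretorsion_theory (prod_cat I C) (prod_cat I T) (prod_cat I F)))"
proof (intro conjI impI)
  note cat = assms(2) and sub = assms(4,5)
  show "pretorsion_theory (prod_cat I C) (prod_cat I T) (prod_cat I F) \<longleftrightarrow>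
      (\<forall>i\<in>I. pretorsion_theory (C i) (T i) (F i))"
  proof
    assume "pretorsion_theory (prod_cat I C) (prod_cat I T) (prod_cat I F)"
    from pretorsion_theory_prod_catD[OF sub this assms(3)]
    show "\<forall>i\<in>I. pretorsion_theory (C i) (T i) (F i)" by simp
  next
    assume "\<forall>i\<in>I. pretorsion_theory (C i) (T i) (F i)"
    then show "pretorsion_theory (prod_cat I C) (prod_cat I T) (prod_cat I F)"
      by (intro pretorsion_theory_prod_catI[OF sub]) auto
  qed
  assume pt: "\<forall>i\<in>I. pretorsion_theory (C i) (T i) (F i)"
  then have prod_pt: "pretorsion_theory (prod_cat I C) (prod_cat I T) (prod_cat I F)"
    by (intro pretorsion_theory_prod_catI[OF sub]) auto
  \<comment> \<open>Any object of the product will do: T2 turns it into the base sequence with which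
    data of a single factor are padded.\<close>
  obtain Z where "Z \<in> Obj (prod_cat I C)"
    using assms(3) PiE_eq_empty_iff[of I "\<lambda>i. Obj (C i)"] unfolding prod_cat_simps by blast
  then obtain n d where base: "torsion_sequence (prod_cat I C) (prod_cat I T) (prod_cat I F) Z (n, d)"
    using prod_pt unfolding pretorsion_theory_def by force
  \<comment> \<open>From here on thinness is handled only through these two conditions, in the
    factors as well as in the product, and no chosen sequence is compared with another.\<close>
  have thin: "thin_pretorsion_theory (C i) (T i) (F i) \<longleftrightarrow>
      unique_fillers (C i) (T i) (F i) \<and> realises_pairs (C i) (T i) (F i)" if "i \<in> I" for i
    by (rule pretorsion_category.thin_pretorsion_theory_iff, intro pretorsion_category.intro
        pretorsion_category_axioms.intro cat[OF that] bspec[OF pt that])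
  have prod_thin: "thin_pretorsion_theory (prod_cat I C) (prod_cat I T) (prod_cat I F) \<longleftrightarrow>
      unique_fillers (prod_cat I C) (prod_cat I T) (prod_cat I F) \<and>
      realises_pairs (prod_cat I C) (prod_cat I T) (prod_cat I F)"
    by (rule pretorsion_category.thin_pretorsion_theory_iff, intro pretorsion_category.intro
        pretorsion_category_axioms.intro category_prod_cat[OF cat] prod_pt)
  show "(\<forall>i\<in>I. thin_pretorsion_theory (C i) (T i) (F i)) \<longleftrightarrow>
      thin_pretorsion_theory (prod_cat I C) (prod_cat I T) (prod_cat I F)"
  proof
    assume "\<forall>i\<in>I. thin_pretorsion_theory (C i) (T i) (F i)"
    then have "unique_fillers (C i) (T i) (F i)" "realises_pairs (C i) (T i) (F i)" if "i \<in> I" for i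
      using thin[OF that] that by simp_all
    then show "thin_pretorsion_theory (prod_cat I C) (prod_cat I T) (prod_cat I F)"
      unfolding prod_thin by (intro conjI unique_fillers_prod_catI realises_pairs_prod_catI)
  next
    assume "thin_pretorsion_theory (prod_cat I C) (prod_cat I T) (prod_cat I F)"
    then have prod: "unique_fillers (prod_cat I C) (prod_cat I T) (prod_cat I F)"
      "realises_pairs (prod_cat I C) (prod_cat I T) (prod_cat I F)"
      unfolding prod_thin by auto
    show "\<forall>i\<in>I. thin_pretorsion_theory (C i) (T i) (F i)"
    proof
      fix i assume i: "i \<in> I"
      show "thin_pretorsion_theory (C i) (T i) (F i)"
        using thin[OF i] unique_fillers_prod_catD[OF cat prod(1) base i]
          realises_pairs_prod_catD[OF prod(2) base i] by simp
    qed
  qed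
qed

end
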